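(* Let $M(n)$ and $T^\ast(n)$ be defined by $$\sum_{n\ge 0} M(n)q^n=\frac{f_2^5f_5^5}{f_1f_{10}},\qquad \sum_{n\ge 0} T^\ast(n)q^n=\frac{f_1^5f_{10}^5}{f_2f_5}.$$ Then for all integers $k\geq 1$ and $n\geq -1$, $$M(2^kn+2^{k+1}-1)\equiv 0\pmod{2^{k-1}},\qquad T^\ast(2^kn+2^{k+1}-2)\equiv 0\pmod{2^{k-1}}.$$
   Context: For a positive integer $m$, $f_m:=\prod_{n=1}^\infty(1-q^{mn})$, regarded as a formal power series in $q$ (or for $|q|<1$). *)

theory Defs
  imports "HOL-Analysis.Analysis" "HOL-Computational_Algebra.Formal_Power_Series"
    "HOL-Number_Theory.Cong"
begin

text \<open>
  The product is taken in \<open>\<int>[[q]]\<close> with its \<open>q\<close>-adic topology. Since \<^const>\<open>prodinf\<close> starts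
  at index \<open>0\<close>, the factor \<open>1 - q^(m n)\<close>, \<open>n \<ge> 1\<close>, appears at index \<open>n - 1\<close>.
  Only \<open>m > 0\<close> is meaningful; the lemma \<open>has_prod_euler_f\<close> shows that the product then converges.
\<close>

definition euler_f :: "nat \<Rightarrow> int fps" where
  "euler_f m = (\<Prod>n. 1 - fps_X ^ (m * Suc n))"

text \<open>
  The type \<^typ>\<open>int fps\<close> has no division operation, so the quotients are formed with the inverse
  of the denominator, whose constant term is \<open>1\<close>. The lemmas \<open>M_generating_function\<close> and
  \<open>Tstar_generating_function\<close> confirm that these are the true quotients.
\<close>

definition M :: "nat \<Rightarrow> int" where
  "M n = fps_nth (euler_f 2 ^ 5 * euler_f 5 ^ 5 *
                    fps_right_inverse (euler_f 1 * euler_f 10) 1) n"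

definition Tstar :: "nat \<Rightarrow> int" where
  "Tstar n = fps_nth (euler_f 1 ^ 5 * euler_f 10 ^ 5 *
                        fps_right_inverse (euler_f 2 * euler_f 5) 1) n"

lemma euler_f_aux:
  assumes "m > 0"
  shows "(\<lambda>n. 1 - fps_X ^ (m * Suc n)) has_prod euler_f m \<and> fps_nth (euler_f m) 0 = 1"
proof -
  let ?f = "\<lambda>n. 1 - fps_X ^ (m * Suc n) :: int fps"
  have f0: "fps_nth (?f n) 0 = 1" for n
    using assms by simp
  have nz: "?f n \<noteq> 0" for n
    using f0[of n] by (metis fps_zero_nth zero_neq_one)
  have sd: "subdegree (?f k - 1) > n" if "k > n" for n k
  proof -
    have "subdegree (?f k - 1) = m * Suc k"
      by simp
    moreover have "m * Suc k \<ge> Suc k"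
      using assms by (cases m) auto
    ultimately show ?thesis
      using that by linarith
  qed
  obtain P where P: "(\<lambda>n. \<Prod>k\<le>n. ?f k) \<longlonglongrightarrow> P"
    using tendsto_prod_fps[of ?f "\<lambda>n. n", OF nz sd] by blast
  have "eventually (\<lambda>n. fps_nth (\<Prod>k\<le>n. ?f k) 0 = fps_nth P 0) sequentially"
    using P unfolding tendsto_fps_iff by blast
  moreover have "fps_nth (\<Prod>k\<le>n. ?f k) 0 = 1" for n
  proof (induction n)
    case 0
    show ?case using assms by simp
  next
    case (Suc n)
    thus ?case by (simp only: prod.atMost_Suc fps_mult_nth_0 f0 mult_1_right)
  qed
  ultimately have P0: "fps_nth P 0 = 1"
    by (auto simp: eventually_sequentially)
  hence "P \<noteq> 0"
    by auto
  with P have "?f has_prod P"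
    by (simp add: has_prod_def raw_has_prod_def)
  moreover from this have "P = euler_f m"
    unfolding euler_f_def by (rule has_prod_unique)
  ultimately show ?thesis
    using P0 by blast
qed

lemma has_prod_euler_f:
  "m > 0 \<Longrightarrow> (\<lambda>n. 1 - fps_X ^ (m * Suc n)) has_prod euler_f m"
  using euler_f_aux by blast

lemma euler_f_nth_0: "m > 0 \<Longrightarrow> fps_nth (euler_f m) 0 = 1"
  using euler_f_aux by blast

lemma M_generating_function:
  "Abs_fps M * (euler_f 1 * euler_f 10) = euler_f 2 ^ 5 * euler_f 5 ^ 5"
proof -
  have "Abs_fps M = euler_f 2 ^ 5 * euler_f 5 ^ 5 * fps_right_inverse (euler_f 1 * euler_f 10) 1"
    by (rule fps_ext) (simp add: M_def)
  moreover have "euler_f 1 * euler_f 10 * fps_right_inverse (euler_f 1 * euler_f 10) 1 = 1"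
    by (rule fps_right_inverse) (simp add: euler_f_nth_0)
  ultimately show ?thesis
    by (simp add: mult.assoc mult.commute mult.left_commute)
qed

lemma Tstar_generating_function:
  "Abs_fps Tstar * (euler_f 2 * euler_f 5) = euler_f 1 ^ 5 * euler_f 10 ^ 5"
proof -
  have "Abs_fps Tstar = euler_f 1 ^ 5 * euler_f 10 ^ 5 * fps_right_inverse (euler_f 2 * euler_f 5) 1"
    by (rule fps_ext) (simp add: Tstar_def)
  moreover have "euler_f 2 * euler_f 5 * fps_right_inverse (euler_f 2 * euler_f 5) 1 = 1"
    by (rule fps_right_inverse) (simp add: euler_f_nth_0)
  ultimately show ?thesis
    by (simp add: mult.assoc mult.commute mult.left_commute)
qed

end

theory Submission
  imports Defs "HOL-Computational_Algebra.Formal_Laurent_Series"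
begin

text \<open>
  The series \<open>F = \<Sum> M(n) q^(n+1)\<close> and \<open>G = \<Sum> T*(n) q^(n+2)\<close> are cusp forms of weight 4 and level 10,
  and the claim concerns the iterates of \<open>U : \<Sum> a(n) q^n \<mapsto> \<Sum> a(2n) q^n\<close> on them. Here \<open>F + G\<close> is
  the newform of level 10, with \<open>U (F + G) = 2 (F + G)\<close>, while \<open>F - G = h(q) + 4 h(q^2)\<close> for the newform
  \<open>h = q f_1^4 f_5^4\<close> of level 5, with \<open>U h = - 4 h - 8 h(q^2)\<close> and \<open>U (h(q^2)) = h\<close>. Consequently
  \<open>U^k (F + G)\<close> and \<open>U^k (F - G)\<close> are both divisible by \<open>2^k\<close>, which gives \<open>2^(k-1)\<close> for \<open>F\<close> and \<open>G\<close>.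

  With Ramanujan's \<open>\<phi>(q) = \<Sum> q^(n^2)\<close> (a sum over all integers) and \<open>\<psi>(q) = \<Sum> q^(n(n+1)/2)\<close>
  (over \<open>n \<ge> 0\<close>), put \<open>P = \<psi>(q)^2\<close>, \<open>Q = q \<psi>(q^5)^2\<close> and \<open>z = f_1 f_5\<close>. All these forms are
  \<open>q\<close> times polynomials in \<open>P\<close>, \<open>Q\<close> and \<open>z\<close>, and everything reduces to
  \<open>P - Q = f_2 f_5^3 / (f_1 f_10)\<close>, \<open>z^2 = (P - Q) (P - 5 Q)\<close> and
  \<open>z = \<psi>(q^2) \<phi>(q^5) - q \<phi>(q) \<psi>(q^10)\<close>. By the Jacobi triple product these
  are identities between series over rank-2 lattices, proved by unimodular and index-changing substitutions.
\<close>

section \<open>Euler products and Gaussian binomials\<close>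

text \<open>Congruence modulo \<open>q^(N+1)\<close>. Infinite products and sums are compared
  through finite truncations, and \<open>fcong_eqI\<close> turns agreement for every
  \<open>N\<close> into equality.\<close>

definition fcong :: "nat \<Rightarrow> int fps \<Rightarrow> int fps \<Rightarrow> bool" where
  "fcong N F G \<longleftrightarrow> (\<forall>n\<le>N. fps_nth F n = fps_nth G n)"

lemma fcong_refl [simp]: "fcong N F F"
  by (simp add: fcong_def)

lemma fcong_sym: "fcong N F G \<Longrightarrow> fcong N G F"
  by (simp add: fcong_def)

lemma fcong_trans [trans]: "fcong N F G \<Longrightarrow> fcong N G H \<Longrightarrow> fcong N F H"
  by (simp add: fcong_def)

lemma fcong_mult: "fcong N F F' \<Longrightarrow> fcong N G G' \<Longrightarrow> fcong N (F * G) (F' * G')"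
  by (auto simp: fcong_def fps_mult_nth intro!: sum.cong)

lemma fcong_sum: "(\<And>x. x \<in> A \<Longrightarrow> fcong N (F x) (G x)) \<Longrightarrow> fcong N (sum F A) (sum G A)"
  by (auto simp: fcong_def fps_sum_nth intro!: sum.cong)

lemma fcong_eqI: "(\<And>N. fcong N F G) \<Longrightarrow> F = G"
  by (auto simp: fcong_def fps_eq_iff)

lemma fcong_cancel:
  assumes "fcong N (F * H) (G * H)" and "fps_nth H 0 = 1"
  shows "fcong N F G"
proof -
  have inv: "H * fps_right_inverse H 1 = 1"
    by (rule fps_right_inverse) (simp add: assms(2))
  have "fcong N (F * H * fps_right_inverse H 1) (G * H * fps_right_inverse H 1)"
    by (intro fcong_mult assms fcong_refl)
  thus ?thesis
    by (simp only: mult.assoc inv mult_1_right)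
qed

lemma fcong_prod_1:
  assumes "\<And>k. k \<in> T \<Longrightarrow> N < k"
  shows "fcong N (\<Prod>k\<in>T. 1 + fps_const s * fps_X ^ k) 1"
  using assms
proof (induction T rule: infinite_finite_induct)
  case (insert k T)
  have "fcong N (1 + fps_const s * fps_X ^ k) 1"
    using insert.prems by (fastforce simp: fcong_def)
  hence "fcong N ((1 + fps_const s * fps_X ^ k) * (\<Prod>k\<in>T. 1 + fps_const s * fps_X ^ k)) (1 * 1)"
    using insert by (intro fcong_mult) auto
  thus ?case
    using insert by simp
qed auto

lemma fcong_prod:
  assumes "finite T'" "T \<subseteq> T'" "\<And>k. k \<in> T' - T \<Longrightarrow> N < k"
  shows "fcong N (\<Prod>k\<in>T'. 1 + fps_const s * fps_X ^ k) (\<Prod>k\<in>T. 1 + fps_const s * fps_X ^ k)"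
proof -
  have "fcong N ((\<Prod>k\<in>T'-T. 1 + fps_const s * fps_X ^ k) * (\<Prod>k\<in>T. 1 + fps_const s * fps_X ^ k))
           (1 * (\<Prod>k\<in>T. 1 + fps_const s * fps_X ^ k))"
    using assms by (intro fcong_mult fcong_prod_1) auto
  thus ?thesis
    by (simp only: prod.subset_diff[OF assms(2,1)] mult_1_left)
qed

text \<open>The product of \<open>1 + s q^k\<close> over \<open>k \<in> S\<close>; an element \<open>0\<close> of \<open>S\<close> is ignored.\<close>

definition eprod :: "int \<Rightarrow> nat set \<Rightarrow> int fps" where
  "eprod s S = Abs_fps (\<lambda>n. fps_nth (\<Prod>k\<in>S \<inter> {1..n}. 1 + fps_const s * fps_X ^ k) n)"

text \<open>Factors with exponent above \<open>n\<close> do not affect coefficient \<open>n\<close>.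
  The freedom in choosing \<open>T\<close> allows comparison with finite products over any
  convenient index set.\<close>

lemma fcong_eprod:
  assumes "finite T" "T \<subseteq> S" "0 \<notin> T" "S \<inter> {1..N} \<subseteq> T"
  shows "fcong N (eprod s S) (\<Prod>k\<in>T. 1 + fps_const s * fps_X ^ k)"
  unfolding fcong_def
proof (intro allI impI)
  fix n assume "n \<le> N"
  have "S \<inter> {1..n} \<subseteq> T"
    using assms(4) \<open>n \<le> N\<close> by fastforce
  moreover have "n < k" if "k \<in> T - S \<inter> {1..n}" for k
    using that assms(2,3) by (cases k) auto
  ultimately have "fcong n (\<Prod>k\<in>T. 1 + fps_const s * fps_X ^ k) (\<Prod>k\<in>S \<inter> {1..n}. 1 + fps_const s * fps_X ^ k)"
    using assms(1) by (intro fcong_prod)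
  thus "fps_nth (eprod s S) n = fps_nth (\<Prod>k\<in>T. 1 + fps_const s * fps_X ^ k) n"
    by (simp add: fcong_def eprod_def)
qed

lemma fcong_eprod_atLeastAtMost:
  "fcong N (eprod s S) (\<Prod>k\<in>S \<inter> {1..N}. 1 + fps_const s * fps_X ^ k)"
  by (rule fcong_eprod) auto

lemma eprod_nth_0: "fps_nth (eprod s S) 0 = 1"
  by (simp add: eprod_def)

lemma eprod_nonzero: "eprod s S \<noteq> 0"
  using eprod_nth_0[of s S] by auto

lemma eprod_Un:
  assumes "S \<inter> T = {}"
  shows "eprod s (S \<union> T) = eprod s S * eprod s T"
proof (rule fcong_eqI)
  fix N
  have "fcong N (eprod s (S \<union> T)) (\<Prod>k\<in>(S \<union> T) \<inter> {1..N}. 1 + fps_const s * fps_X ^ k)"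
    by (rule fcong_eprod_atLeastAtMost)
  also have "(\<Prod>k\<in>(S \<union> T) \<inter> {1..N}. 1 + fps_const s * fps_X ^ k) =
      (\<Prod>k\<in>S \<inter> {1..N}. 1 + fps_const s * fps_X ^ k) * (\<Prod>k\<in>T \<inter> {1..N}. 1 + fps_const s * fps_X ^ k)"
    unfolding Int_Un_distrib2 using assms by (intro prod.union_disjoint) auto
  also have "fcong N \<dots> (eprod s S * eprod s T)"
    by (intro fcong_mult fcong_sym[OF fcong_eprod_atLeastAtMost])
  finally show "fcong N (eprod s (S \<union> T)) (eprod s S * eprod s T)" .
qed

text \<open>Factor by factor, \<open>(1 + q^k) (1 - q^k) = 1 - q^(2k)\<close>.\<close>

lemma eprod_pos_neg: "eprod 1 S * eprod (-1) S = eprod (-1) ((\<lambda>k. 2 * k) ` S)"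
proof (rule fcong_eqI)
  fix N
  have "fcong N (eprod 1 S * eprod (-1) S)
    ((\<Prod>k\<in>S \<inter> {1..N}. 1 + fps_const 1 * fps_X ^ k) * (\<Prod>k\<in>S \<inter> {1..N}. 1 + fps_const (-1) * fps_X ^ k))"
    by (intro fcong_mult fcong_eprod_atLeastAtMost)
  also have "\<dots> = (\<Prod>k\<in>S \<inter> {1..N}. 1 + fps_const (-1) * fps_X ^ (2 * k))"
  proof -
    have "(1 + fps_const 1 * x) * (1 + fps_const (-1) * x) = 1 + fps_const (-1) * (x * x)" for x :: "int fps"
      by (simp add: algebra_simps flip: fps_const_neg)
    thus ?thesis
      by (simp only: prod.distrib[symmetric] mult_2 power_add)
  qed
  also have "\<dots> = (\<Prod>k\<in>(\<lambda>k. 2 * k) ` (S \<inter> {1..N}). 1 + fps_const (-1) * fps_X ^ k)"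
    by (subst prod.reindex) (auto simp: inj_on_def)
  also have "fcong N \<dots> (eprod (-1) ((\<lambda>k. 2 * k) ` S))"
    by (rule fcong_sym, rule fcong_eprod) auto
  finally show "fcong N (eprod 1 S * eprod (-1) S) (eprod (-1) ((\<lambda>k. 2 * k) ` S))" .
qed

text \<open>Replaces the topological product by one over a set of exponents, so that it can be split
  by residue classes.\<close>

lemma euler_f_eq_eprod:
  assumes "m > 0"
  shows "euler_f m = eprod (-1) {k. m dvd k}"
proof (rule fcong_eqI)
  fix N
  have "(\<lambda>n. \<Prod>k\<le>n. 1 - fps_X ^ (m * Suc k)) \<longlonglongrightarrow> euler_f m"
    using has_prod_imp_tendsto[OF has_prod_euler_f[OF assms]] .
  hence "\<forall>n. eventually (\<lambda>j. fps_nth (\<Prod>k\<le>j. 1 - fps_X ^ (m * Suc k)) n = fps_nth (euler_f m) n) sequentially"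
    by (simp add: tendsto_fps_iff)
  \<comment> \<open>Convergence is coefficientwise, so the finitely many coefficients up to
    \<open>N\<close> are all final from some partial product on.\<close>
  hence "eventually (\<lambda>j. \<forall>n\<in>{..N}. fps_nth (\<Prod>k\<le>j. 1 - fps_X ^ (m * Suc k)) n = fps_nth (euler_f m) n) sequentially"
    by (intro eventually_ball_finite) auto
  moreover have "eventually (\<lambda>j. j \<ge> N) sequentially"
    by (rule eventually_ge_at_top)
  ultimately have "eventually (\<lambda>j. (\<forall>n\<in>{..N}. fps_nth (\<Prod>k\<le>j. 1 - fps_X ^ (m * Suc k)) n =
      fps_nth (euler_f m) n) \<and> j \<ge> N) sequentially"
    by (rule eventually_conj)
  then obtain j where j: "j \<ge> N" "fcong N (\<Prod>k\<le>j. 1 - fps_X ^ (m * Suc k)) (euler_f m)"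
    unfolding fcong_def by (auto dest: eventually_happens'[OF sequentially_bot])
  have "inj_on (\<lambda>k. m * Suc k) {..j}"
    using assms by (auto simp: inj_on_def)
  moreover have "1 - x = 1 + fps_const (-1) * x" for x :: "int fps"
    by (simp flip: fps_const_neg)
  ultimately have "(\<Prod>k\<le>j. 1 - fps_X ^ (m * Suc k) :: int fps) =
      (\<Prod>k\<in>(\<lambda>k. m * Suc k) ` {..j}. 1 + fps_const (-1) * fps_X ^ k)"
    by (simp only: prod.reindex o_def)
  moreover have "fcong N (eprod (-1) {k. m dvd k}) (\<Prod>k\<in>(\<lambda>k. m * Suc k) ` {..j}. 1 + fps_const (-1) * fps_X ^ k)"
  proof (rule fcong_eprod)
    show "{k. m dvd k} \<inter> {1..N} \<subseteq> (\<lambda>k. m * Suc k) ` {..j}"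
    proof
      fix x assume "x \<in> {k. m dvd k} \<inter> {1..N}"
      then obtain k where k: "x = m * k" "1 \<le> x" "x \<le> N"
        by auto
      then obtain l where "k = Suc l"
        by (cases k) auto
      moreover have "k \<le> x"
        using k assms by simp
      ultimately show "x \<in> (\<lambda>k. m * Suc k) ` {..j}"
        using k j by (intro image_eqI[of _ _ l]) auto
    qed
  qed (use assms in auto)
  ultimately have "fcong N (eprod (-1) {k. m dvd k}) (\<Prod>k\<le>j. 1 - fps_X ^ (m * Suc k))"
    by (simp only:)
  from fcong_sym[OF fcong_trans[OF this j(2)]]
  show "fcong N (euler_f m) (eprod (-1) {k. m dvd k})" .
qed

text \<open>Gaussian binomials through the q-Pascal rule, which needs no division. For
  \<open>k > n\<close> the truncated exponent \<open>n - k\<close> does no harm, since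
  \<open>qbin q n k\<close> is then 0.\<close>

fun qbin :: "'a::comm_ring_1 \<Rightarrow> nat \<Rightarrow> nat \<Rightarrow> 'a" where
  "qbin q n 0 = 1"
| "qbin q 0 (Suc k) = 0"
| "qbin q (Suc n) (Suc k) = qbin q n (Suc k) + q ^ (n - k) * qbin q n k"

lemma qbin_eq_0: "n < k \<Longrightarrow> qbin q n k = 0"
  by (induction q n k rule: qbin.induct) auto

definition qpoch :: "'a::comm_ring_1 \<Rightarrow> nat \<Rightarrow> 'a" where
  "qpoch q n = (\<Prod>k=1..n. 1 - q ^ k)"

lemma qpoch_0 [simp]: "qpoch q 0 = 1"
  and qpoch_Suc: "qpoch q (Suc n) = qpoch q n * (1 - q ^ Suc n)"
  by (simp_all add: qpoch_def)

text \<open>The quotient formula for Gaussian binomials without division. With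
  \<open>n = k + 1 + d\<close>, the induction rests on
  \<open>(1 - q^(d+1)) + q^(d+1) (1 - q^(k+1)) = 1 - q^(n+1)\<close>.\<close>

lemma qbin_qpoch: "k \<le> n \<Longrightarrow> qbin q n k * qpoch q k * qpoch q (n - k) = qpoch q n"
proof (induction q n k rule: qbin.induct)
  case (3 q n k)
  show ?case
  proof (cases "k = n")
    case True
    thus ?thesis
      using "3.IH"(2) by (simp add: qpoch_Suc qbin_eq_0 flip: mult.assoc)
  next
    case False
    define d where "d = n - Suc k"
    have n: "n = Suc k + d" "n - k = Suc d" "n - Suc k = d"
      using False "3.prems" by (auto simp: d_def)
    have 1: "qbin q n (Suc k) * qpoch q (Suc k) * qpoch q d = qpoch q n"
      and 2: "qbin q n k * qpoch q k * qpoch q (Suc d) = qpoch q n"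
      using "3.IH" n by auto
    define r u where "r = q ^ Suc d" and "u = q ^ Suc k"
    have rec: "qbin q (Suc n) (Suc k) = qbin q n (Suc k) + q ^ Suc d * qbin q n k"
      using n(2) by simp
    have "qbin q (Suc n) (Suc k) * qpoch q (Suc k) * qpoch q (Suc d) =
      (qbin q n (Suc k) * qpoch q (Suc k) * qpoch q d) * (1 - q ^ Suc d) +
      q ^ Suc d * (1 - q ^ Suc k) * (qbin q n k * qpoch q k * qpoch q (Suc d))"
      unfolding rec qpoch_Suc r_def[symmetric] u_def[symmetric] by (simp add: algebra_simps)
    also have "\<dots> = qpoch q n * (1 - q ^ Suc d * q ^ Suc k)"
      unfolding 1 2 by (simp add: algebra_simps del: power_Suc)
    also have "\<dots> = qpoch q (Suc n)"
      by (simp only: qpoch_Suc n power_add[symmetric]) (simp add: algebra_simps)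
    finally show ?thesis
      by (simp add: n)
  qed
qed auto

lemma qbinomial:
  "(\<Prod>k<n. x + y * q ^ k) = (\<Sum>j\<le>n. qbin q n j * q ^ (j * (j - 1) div 2) * y ^ j * x ^ (n - j))"
proof (induction n)
  case (Suc n)
  let ?t = "\<lambda>j. j * (j - 1) div 2"
  have tri: "?t (Suc j) = ?t j + j" for j :: nat
    by (induction j) auto
  \<comment> \<open>The q-Pascal rule splits the sum. Its first part, rejoined with the term
    \<open>j = 0\<close>, gives the factor \<open>x\<close>; the second gives
    \<open>y * q^n\<close>, because \<open>q^(n-j) * q^j = q^n\<close>.\<close>
  have "(\<Sum>j\<le>Suc n. qbin q (Suc n) j * q ^ ?t j * y ^ j * x ^ (Suc n - j)) =
     x ^ Suc n + (\<Sum>j\<le>n. qbin q n (Suc j) * q ^ ?t (Suc j) * y ^ Suc j * x ^ (n - j)) +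
     (\<Sum>j\<le>n. q ^ (n - j) * qbin q n j * q ^ ?t (Suc j) * y ^ Suc j * x ^ (n - j))"
    by (subst sum.atMost_Suc_shift) (simp add: algebra_simps sum.distrib)
  also have "x ^ Suc n + (\<Sum>j\<le>n. qbin q n (Suc j) * q ^ ?t (Suc j) * y ^ Suc j * x ^ (n - j)) =
     (\<Sum>j\<le>Suc n. qbin q n j * q ^ ?t j * y ^ j * x ^ (Suc n - j))"
    by (subst sum.atMost_Suc_shift) simp
  also have "\<dots> = (\<Sum>j\<le>n. qbin q n j * q ^ ?t j * y ^ j * x ^ (n - j)) * x"
    by (simp add: qbin_eq_0 sum_distrib_left sum_distrib_right Suc_diff_le mult_ac)
  also have "(\<Sum>j\<le>n. q ^ (n - j) * qbin q n j * q ^ ?t (Suc j) * y ^ Suc j * x ^ (n - j)) =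
     (\<Sum>j\<le>n. qbin q n j * q ^ ?t j * y ^ j * x ^ (n - j)) * (y * q ^ n)"
    unfolding sum_distrib_right
  proof (intro sum.cong refl)
    fix j assume "j \<in> {..n}"
    hence "q ^ n = q ^ (n - j) * q ^ j"
      by (simp flip: power_add)
    thus "q ^ (n - j) * qbin q n j * q ^ ?t (Suc j) * y ^ Suc j * x ^ (n - j) =
       qbin q n j * q ^ ?t j * y ^ j * x ^ (n - j) * (y * q ^ n)"
      by (simp only: tri power_add power_Suc mult_ac)
  qed
  finally show ?case
    unfolding prod.lessThan_Suc Suc.IH distrib_left by (rule sym)
qed simp

section \<open>The Jacobi triple product\<close>

definition tri :: "int \<Rightarrow> int" where
  "tri n = n * (n + 1) div 2"

lemma two_tri: "2 * tri n = n * (n + 1)"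
  unfolding tri_def by (rule dvd_mult_div_cancel) simp

lemma tri_plus_1: "tri (n + 1) = tri n + n + 1"
  using two_tri[of n] two_tri[of "n + 1"] by (simp add: algebra_simps)

lemma tri_nonneg: "tri n \<ge> 0"
proof -
  have "n * (n + 1) \<ge> 0"
    by (cases "n \<ge> 0") (auto intro: mult_nonneg_nonneg mult_nonpos_nonpos)
  thus ?thesis
    using two_tri[of n] by linarith
qed

lemma abs_le_tri: "\<bar>n\<bar> \<le> tri n + tri (n - 1)"
proof -
  have "tri n + tri (n - 1) = n * n"
    using two_tri[of n] two_tri[of "n - 1"] by (simp add: algebra_simps)
  moreover have "\<bar>n\<bar> \<le> n * n"
    using mult_left_mono[of 1 "\<bar>n\<bar>" "\<bar>n\<bar>"] by (cases "n = 0") auto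
  ultimately show ?thesis
    by simp
qed

text \<open>Only meaningful if \<open>e\<close> is nonnegative with finite fibres on \<open>A\<close> (\<open>locally_finite\<close> below).\<close>

definition lattice_series :: "'a set \<Rightarrow> ('a \<Rightarrow> int) \<Rightarrow> ('a \<Rightarrow> int) \<Rightarrow> int fps" where
  "lattice_series A e w = Abs_fps (\<lambda>n. \<Sum>x | x \<in> A \<and> e x = int n. w x)"

text \<open>The exponent in Ramanujan's \<open>f(a, b)\<close>, the sum of
  \<open>a^(n(n+1)/2) b^(n(n-1)/2)\<close>, at \<open>a = q^i\<close> and
  \<open>b = q^j\<close>.\<close>

definition theta_exp :: "nat \<Rightarrow> nat \<Rightarrow> int \<Rightarrow> int" where
  "theta_exp i j n = int i * tri n + int j * tri (n - 1)"

text \<open>For \<open>s = 1\<close> or \<open>s = -1\<close> this is \<open>s^n\<close>, extended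
  to negative \<open>n\<close>. It is the sign in \<open>f(s q^i, s q^j)\<close>, as
  \<open>n(n+1)/2 + n(n-1)/2 = n^2\<close> has the parity of \<open>n\<close>.\<close>

definition parity_sign :: "int \<Rightarrow> int \<Rightarrow> int" where
  "parity_sign s n = (if even n then 1 else s)"

text \<open>This is \<open>f(s q^i, s q^j)\<close> in Ramanujan's notation, for \<open>s = 1\<close> or \<open>s = -1\<close>. Thus \<open>\<phi>(s q^d)\<close> is
  \<open>theta d d s\<close>, \<open>\<psi>(q^d)\<close> is \<open>theta d (3*d) 1\<close>, and \<open>2 \<psi>(q^d)\<close> is \<open>theta d 0 1\<close>.\<close>

definition theta :: "nat \<Rightarrow> nat \<Rightarrow> int \<Rightarrow> int fps" where
  "theta i j s = lattice_series UNIV (theta_exp i j) (parity_sign s)"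

lemma theta_exp_ge:
  assumes "i > 0" "j > 0"
  shows "\<bar>n\<bar> \<le> theta_exp i j n"
proof -
  have "1 * tri n \<le> int i * tri n" "1 * tri (n - 1) \<le> int j * tri (n - 1)"
    using assms by (intro mult_right_mono tri_nonneg; simp)+
  thus ?thesis
    unfolding theta_exp_def using abs_le_tri[of n] by linarith
qed

lemma prod_lessThan_add:
  fixes f :: "nat \<Rightarrow> 'a::comm_monoid_mult"
  shows "(\<Prod>k<m + n. f k) = (\<Prod>k<m. f k) * (\<Prod>k<n. f (m + k))"
  by (induction n) (simp_all add: mult.assoc)

text \<open>The \<open>q\<close>-binomial theorem for \<open>2n\<close> factors \<open>x + Q^k\<close> with \<open>Q = q^d\<close> and \<open>x = s q^j Q^(n-1)\<close>.\<close>

lemma finite_triple_product: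
  fixes i j n :: nat
  assumes "i > 0" "j > 0" "n > 0" and s: "s = 1 \<or> s = -1"
  defines "d \<equiv> i + j"
  shows "(\<Prod>k<n. 1 + fps_const s * fps_X ^ (i + d * k)) * (\<Prod>k<n. 1 + fps_const s * fps_X ^ (j + d * k)) =
    (\<Sum>l\<le>2*n. qbin (fps_X ^ d) (2 * n) l *
       (fps_const (parity_sign s (int l - int n)) * fps_X ^ nat (theta_exp i j (int l - int n))))"
    (is "?A * ?B = (\<Sum>l\<le>_. ?t l)")
proof -
  define h where "h = j + d * (n - 1)"
  define c where "c = fps_const s"
  define K where "K = d * (n * (n - 1) div 2) + h * n"
  have cc: "c * c = 1"
    using s by (auto simp: c_def)
  have half: "2 * int (l * (l - 1) div 2) = int l * (int l - 1)" for l
  proof -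
    have "2 * (l * (l - 1) div 2) = l * (l - 1)"
      by (rule dvd_mult_div_cancel) (cases l; auto)
    hence "2 * int (l * (l - 1) div 2) = int (l * (l - 1))"
      by (metis of_nat_mult of_nat_numeral)
    thus ?thesis
      by (cases l) (auto simp: algebra_simps)
  qed
  \<comment> \<open>The lower half of the factors, in reverse order, yields \<open>?B\<close> after
    extracting powers of \<open>Q\<close>; the upper half yields \<open>?A\<close> after extracting
    \<open>c * q^h\<close> from each factor. The extracted monomial is
    \<open>c^n * q^K\<close>.\<close>
  have "(\<Prod>k<2*n. c * fps_X ^ h + 1 * (fps_X ^ d) ^ k) =
      (\<Prod>k<n. c * fps_X ^ h + (fps_X ^ d) ^ k) * (\<Prod>k<n. c * fps_X ^ h + (fps_X ^ d) ^ (n + k))"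
    unfolding mult_2 mult_1 by (rule prod_lessThan_add)
  also have "(\<Prod>k<n. c * fps_X ^ h + (fps_X ^ d) ^ k) = (\<Prod>k<n. c * fps_X ^ h + (fps_X ^ d) ^ (n - Suc k))"
    by (rule prod.nat_diff_reindex[symmetric])
  also have "\<dots> = (\<Prod>k<n. fps_X ^ (d * (n - Suc k)) * (1 + c * fps_X ^ (j + d * k)))"
  proof (intro prod.cong refl)
    fix k assume "k \<in> {..<n}"
    hence "h = d * (n - Suc k) + (j + d * k)"
      by (simp add: h_def flip: distrib_left)
    thus "c * fps_X ^ h + (fps_X ^ d) ^ (n - Suc k) = fps_X ^ (d * (n - Suc k)) * (1 + c * fps_X ^ (j + d * k))"
      by (simp only: power_add power_mult distrib_left mult_1_left mult_1_right add.commute mult_ac)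
  qed
  also have "\<dots> = (\<Prod>k<n. fps_X ^ (d * (n - Suc k))) * ?B"
    by (simp only: prod.distrib c_def)
  also have "(\<Prod>k<n. fps_X ^ (d * (n - Suc k)) :: int fps) = (\<Prod>k<n. fps_X ^ (d * k))"
    by (rule prod.nat_diff_reindex)
  also have "\<dots> = fps_X ^ (d * (n * (n - 1) div 2))"
    by (simp add: Sum_Ico_nat lessThan_atLeast0 flip: power_sum sum_distrib_left)
  also have "(\<Prod>k<n. c * fps_X ^ h + (fps_X ^ d) ^ (n + k)) = (\<Prod>k<n. c * fps_X ^ h * (1 + c * fps_X ^ (i + d * k)))"
  proof (intro prod.cong refl)
    fix k assume "k \<in> {..<n}"
    have "d * (n + k) = h + (i + d * k)"
      using \<open>n > 0\<close> by (cases n) (auto simp: h_def d_def algebra_simps)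
    hence "(fps_X ^ d) ^ (n + k) = c * c * (fps_X ^ h * fps_X ^ (i + d * k))"
      by (simp only: cc mult_1 flip: power_mult power_add)
    thus "c * fps_X ^ h + (fps_X ^ d) ^ (n + k) = c * fps_X ^ h * (1 + c * fps_X ^ (i + d * k))"
      by (simp only: distrib_left mult_1_left mult_1_right mult_ac)
  qed
  also have "\<dots> = (c * fps_X ^ h) ^ n * ?A"
    by (simp only: prod.distrib c_def prod_constant card_lessThan power_mult_distrib)
  also have "fps_X ^ (d * (n * (n - 1) div 2)) * ?B * ((c * fps_X ^ h) ^ n * ?A) = c ^ n * fps_X ^ K * (?A * ?B)"
    by (simp only: K_def power_add power_mult power_mult_distrib mult_ac)
  finally have "c ^ n * fps_X ^ K * (?A * ?B) = (\<Prod>k<2*n. c * fps_X ^ h + 1 * (fps_X ^ d) ^ k)"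
    by (rule sym)
  also have "\<dots> = (\<Sum>l\<le>2*n. qbin (fps_X ^ d) (2*n) l * (fps_X ^ d) ^ (l * (l - 1) div 2) * 1 ^ l *
      (c * fps_X ^ h) ^ (2*n - l))"
    by (rule qbinomial)
  also have "\<dots> = (\<Sum>l\<le>2*n. c ^ n * fps_X ^ K * ?t l)"
  proof (intro sum.cong refl)
    fix l assume "l \<in> {..2*n}"
    hence l: "l \<le> 2 * n" by simp
    \<comment> \<open>Doubling removes the halves in the triangular numbers and leaves a polynomial
      identity.\<close>
    have "2 * (int d * int (l * (l - 1) div 2) + int h * int (2 * n - l)) = 2 * int K + 2 * theta_exp i j (int l - int n)"
    proof -
      have h: "int h = int j + int d * (int n - 1)"
        using \<open>n > 0\<close> by (simp add: h_def of_nat_diff)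
      have "2 * (int d * int (l * (l - 1) div 2) + int h * int (2 * n - l)) =
          int d * (int l * (int l - 1)) + 2 * int h * (2 * int n - int l)"
        using l by (simp add: distrib_left of_nat_diff flip: half)
      moreover have "2 * int K = int d * (int n * (int n - 1)) + 2 * int h * int n"
        by (simp add: K_def distrib_left flip: half)
      moreover have "2 * theta_exp i j (int l - int n) =
          int i * ((int l - int n) * (int l - int n + 1)) + int j * ((int l - int n - 1) * (int l - int n))"
        unfolding theta_exp_def using two_tri[of "int l - int n"] two_tri[of "int l - int n - 1"]
        by (simp add: distrib_left mult.left_commute[of 2])
      ultimately show ?thesis
        unfolding h d_def by (simp add: algebra_simps)
    qed
    moreover have "theta_exp i j (int l - int n) \<ge> 0"
      using theta_exp_ge[OF assms(1,2), of "int l - int n"] by linarith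
    ultimately have "int (d * (l * (l - 1) div 2) + h * (2 * n - l)) = int (K + nat (theta_exp i j (int l - int n)))"
      by simp
    hence e: "d * (l * (l - 1) div 2) + h * (2 * n - l) = K + nat (theta_exp i j (int l - int n))"
      by (simp only: of_nat_eq_iff)
    have "c ^ (2 * n - l) = c ^ n * fps_const (parity_sign s (int l - int n))"
      using s l by (auto simp: c_def parity_sign_def uminus_power_if fps_const_power)
    thus "qbin (fps_X ^ d) (2*n) l * (fps_X ^ d) ^ (l * (l - 1) div 2) * 1 ^ l * (c * fps_X ^ h) ^ (2*n - l) =
        c ^ n * fps_X ^ K * ?t l"
      using arg_cong[OF e, of "\<lambda>e. (fps_X :: int fps) ^ e"]
      by (simp only: power_add power_mult power_mult_distrib power_one mult_1_left mult_1_right mult_ac)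
  qed
  finally have "c ^ n * fps_X ^ K * (?A * ?B) = c ^ n * fps_X ^ K * (\<Sum>l\<le>2*n. ?t l)"
    by (simp only: sum_distrib_left)
  moreover have "c ^ n * fps_X ^ K \<noteq> 0"
    using s by (auto simp: c_def)
  ultimately show ?thesis
    by (rule mult_left_cancel[THEN iffD1, rotated])
qed

text \<open>The limit of the finite version, carried out modulo \<open>q^(N+1)\<close>: Gaussian
  binomials near the centre become the inverse of \<open>euler_f d\<close>, and all other terms have
  exponents beyond \<open>N\<close>.\<close>

lemma jacobi_triple_product:
  assumes "i > 0" "j > 0" and s: "s = 1 \<or> s = -1"
  shows "theta i j s = eprod s {k. k mod (i + j) = i} * eprod s {k. k mod (i + j) = j} * euler_f (i + j)"
proof (rule fcong_eqI)
  fix N :: nat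
  define d where "d = i + j"
  \<comment> \<open>Large enough that \<open>l\<close> and \<open>2 * n - l\<close> are both at
    least \<open>N\<close> whenever \<open>l\<close> is within \<open>N\<close> of
    \<open>n\<close>.\<close>
  define n where "n = 2 * N + 1"
  let ?t = "\<lambda>l. fps_const (parity_sign s (int l - int n)) * fps_X ^ nat (theta_exp i j (int l - int n)) :: int fps"
  have prod: "fcong N (eprod s {k. k mod d = r}) (\<Prod>k<n. 1 + fps_const s * fps_X ^ (r + d * k))"
    if "r > 0" "r < d" for r
  proof -
    have "(\<Prod>k<n. 1 + fps_const s * fps_X ^ (r + d * k)) =
        (\<Prod>k\<in>(\<lambda>k. r + d * k) ` {..<n}. 1 + fps_const s * fps_X ^ k)"
      using that by (subst prod.reindex) (auto simp: inj_on_def)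
    moreover have "{k. k mod d = r} \<inter> {1..N} \<subseteq> (\<lambda>k. r + d * k) ` {..<n}"
    proof
      fix k assume k: "k \<in> {k. k mod d = r} \<inter> {1..N}"
      have "k div d \<le> k"
        by (rule div_le_dividend)
      moreover have "k \<le> N"
        using k by simp
      ultimately have "k div d < n"
        unfolding n_def by linarith
      moreover have "k = r + d * (k div d)"
        using k by auto
      ultimately show "k \<in> (\<lambda>k. r + d * k) ` {..<n}"
        by blast
    qed
    ultimately show ?thesis
      using that by (simp only:) (rule fcong_eprod, auto)
  qed
  have poch: "fcong N (euler_f d) (qpoch (fps_X ^ d) m)" if "m \<ge> N" for m
  proof -
    have "d > 0" using assms by (simp add: d_def)
    have "qpoch (fps_X ^ d) m = (\<Prod>k\<in>{1..m}. 1 + fps_const (-1) * fps_X ^ (d * k) :: int fps)"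
      by (simp add: qpoch_def power_mult flip: fps_const_neg)
    also have "\<dots> = (\<Prod>k\<in>(\<lambda>k. d * k) ` {1..m}. 1 + fps_const (-1) * fps_X ^ k)"
      using \<open>d > 0\<close> by (subst prod.reindex) (auto simp: inj_on_def)
    finally have "qpoch (fps_X ^ d) m = (\<Prod>k\<in>(\<lambda>k. d * k) ` {1..m}. 1 + fps_const (-1) * fps_X ^ k :: int fps)" .
    moreover have "{k. d dvd k} \<inter> {1..N} \<subseteq> (\<lambda>k. d * k) ` {1..m}"
    proof
      fix x assume x: "x \<in> {k. d dvd k} \<inter> {1..N}"
      then obtain k where k: "x = d * k" by auto
      moreover have "k \<le> x" "k > 0" "k \<le> m"
        using that k \<open>d > 0\<close> x by (auto intro: Nat.gr0I order.trans[of k "d * k"])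
      ultimately show "x \<in> (\<lambda>k. d * k) ` {1..m}"
        using x that k by (intro image_eqI[of _ _ k]) auto
    qed
    ultimately show ?thesis
      using \<open>d > 0\<close> by (simp only: euler_f_eq_eprod) (rule fcong_eprod, auto)
  qed
  have E0: "fps_nth (euler_f d) 0 = 1"
    using assms by (intro euler_f_nth_0) (simp add: d_def)
  have term_fcong: "fcong N (qbin (fps_X ^ d) (2 * n) l * ?t l * euler_f d) (?t l)" if "l \<le> 2 * n" for l
  proof (cases "\<bar>int l - int n\<bar> \<le> int N")
    case True
    hence l: "N \<le> l" "N \<le> 2 * n - l"
      by (auto simp: n_def)
    \<comment> \<open>All three q-factorials in \<open>qbin_qpoch\<close> agree with
      \<open>euler_f d\<close> up to \<open>q^N\<close>, and one copy cancels.\<close>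
    have "fcong N (qbin (fps_X ^ d) (2 * n) l * euler_f d * euler_f d)
        (qbin (fps_X ^ d) (2 * n) l * qpoch (fps_X ^ d) l * qpoch (fps_X ^ d) (2 * n - l))"
      by (intro fcong_mult poch l fcong_refl)
    also have "\<dots> = qpoch (fps_X ^ d) (2 * n)"
      by (rule qbin_qpoch[OF that])
    also have "fcong N \<dots> (1 * euler_f d)"
      unfolding mult_1 by (rule fcong_sym, rule poch) (simp add: n_def)
    finally have "fcong N (qbin (fps_X ^ d) (2 * n) l * euler_f d) 1"
      using E0 by (rule fcong_cancel)
    hence "fcong N (qbin (fps_X ^ d) (2 * n) l * euler_f d * ?t l) (1 * ?t l)"
      by (intro fcong_mult fcong_refl)
    thus ?thesis
      by (simp only: mult_1 mult_ac)
  next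
    case False
    hence "N < nat (theta_exp i j (int l - int n))"
      using theta_exp_ge[OF assms(1,2), of "int l - int n"] by linarith
    hence *: "fcong N (fps_X ^ nat (theta_exp i j (int l - int n))) 0"
      by (simp add: fcong_def)
    have "fcong N (F * fps_X ^ nat (theta_exp i j (int l - int n))) 0" for F
      using fcong_mult[OF fcong_refl *, of F] by simp
    from fcong_trans[OF this[of "qbin (fps_X ^ d) (2 * n) l * fps_const (parity_sign s (int l - int n)) * euler_f d"]
        fcong_sym[OF this[of "fps_const (parity_sign s (int l - int n))"]]]
    show ?thesis
      by (simp only: mult_ac)
  qed
  have "fcong N (theta i j s) (\<Sum>l\<le>2*n. ?t l)"
    unfolding fcong_def
  proof (intro allI impI)
    fix p assume "p \<le> N"
    have nn: "theta_exp i j m \<ge> 0" for m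
      using theta_exp_ge[OF assms(1,2), of m] by linarith
    have "fps_nth (\<Sum>l\<le>2*n. ?t l) p =
        (\<Sum>l\<le>2*n. if theta_exp i j (int l - int n) = int p then parity_sign s (int l - int n) else 0)"
      unfolding fps_sum_nth using nn by (intro sum.cong refl) (auto simp: fps_mult_left_const_nth)
    also have "\<dots> = (\<Sum>l | l \<in> {..2*n} \<and> theta_exp i j (int l - int n) = int p. parity_sign s (int l - int n))"
      by (rule sum.inter_filter[symmetric]) simp
    also have "\<dots> = (\<Sum>m | theta_exp i j m = int p. parity_sign s m)"
    proof (rule sum.reindex_bij_witness[of _ "\<lambda>m. nat (m + int n)" "\<lambda>l. int l - int n"])
      fix m assume m: "m \<in> {m. theta_exp i j m = int p}"
      hence "\<bar>m\<bar> \<le> int p"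
        using theta_exp_ge[OF assms(1,2), of m] by auto
      thus "int (nat (m + int n)) - int n = m"
        "nat (m + int n) \<in> {l \<in> {..2*n}. theta_exp i j (int l - int n) = int p}"
        using \<open>p \<le> N\<close> m by (auto simp: n_def)
    qed auto
    finally show "fps_nth (theta i j s) p = fps_nth (\<Sum>l\<le>2*n. ?t l) p"
      by (simp add: theta_def lattice_series_def)
  qed
  also have "fcong N \<dots> (\<Sum>l\<le>2*n. qbin (fps_X ^ d) (2 * n) l * ?t l * euler_f d)"
    by (intro fcong_sum fcong_sym[OF term_fcong]) auto
  also have "\<dots> = (\<Prod>k<n. 1 + fps_const s * fps_X ^ (i + d * k)) *
      (\<Prod>k<n. 1 + fps_const s * fps_X ^ (j + d * k)) * euler_f d"
    unfolding sum_distrib_right[symmetric] d_def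
    by (subst finite_triple_product[OF assms(1,2) _ s]) (simp_all add: n_def)
  also have "fcong N \<dots> (eprod s {k. k mod d = i} * eprod s {k. k mod d = j} * euler_f d)"
    using assms by (intro fcong_mult fcong_refl fcong_sym[OF prod]) (auto simp: d_def)
  finally show "fcong N (theta i j s)
      (eprod s {k. k mod (i + j) = i} * eprod s {k. k mod (i + j) = j} * euler_f (i + j))"
    by (simp only: d_def)
qed

section \<open>Series over lattices\<close>

definition locally_finite :: "'a set \<Rightarrow> ('a \<Rightarrow> int) \<Rightarrow> bool" where
  "locally_finite A e \<longleftrightarrow> (\<forall>x\<in>A. 0 \<le> e x) \<and> (\<forall>n. finite {x \<in> A. e x = n})"

lemma locally_finite_subset: "locally_finite A e \<Longrightarrow> B \<subseteq> A \<Longrightarrow> locally_finite B e"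
  by (auto simp: locally_finite_def intro: rev_finite_subset[of "{x \<in> A. e x = _}"])

lemma locally_finite_Times:
  assumes "locally_finite A e" "locally_finite B e'"
  shows "locally_finite (A \<times> B) (\<lambda>(x, y). e x + e' y)"
  unfolding locally_finite_def
proof (intro conjI allI)
  show "\<forall>z\<in>A \<times> B. 0 \<le> (case z of (x, y) \<Rightarrow> e x + e' y)"
    using assms by (auto simp: locally_finite_def)
next
  fix n
  have "{z \<in> A \<times> B. (case z of (x, y) \<Rightarrow> e x + e' y) = n} \<subseteq>
      (\<Union>i\<in>{0..n}. {x \<in> A. e x = i} \<times> {y \<in> B. e' y = n - i})"
  proof
    fix z assume "z \<in> {z \<in> A \<times> B. (case z of (x, y) \<Rightarrow> e x + e' y) = n}"
    then obtain x y where z: "z = (x, y)" "x \<in> A" "y \<in> B" "e x + e' y = n"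
      by auto
    moreover from z have "0 \<le> e x" "0 \<le> e' y"
      using assms by (auto simp: locally_finite_def)
    ultimately have "e x \<in> {0..n}" "z \<in> {x' \<in> A. e x' = e x} \<times> {y \<in> B. e' y = n - e x}"
      by auto
    thus "z \<in> (\<Union>i\<in>{0..n}. {x \<in> A. e x = i} \<times> {y \<in> B. e' y = n - i})"
      by blast
  qed
  moreover have "finite (\<Union>i\<in>{0..n}. {x \<in> A. e x = i} \<times> {y \<in> B. e' y = n - i})"
    using assms by (intro finite_UN_I finite_cartesian_product) (auto simp: locally_finite_def)
  ultimately show "finite {z \<in> A \<times> B. (case z of (x, y) \<Rightarrow> e x + e' y) = n}"
    by (rule finite_subset)
qed

text \<open>Cauchy product: the fibre over \<open>n\<close> is partitioned by the value of the first
  exponent.\<close>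

lemma lattice_series_mult:
  assumes "locally_finite A e" "locally_finite B e'"
  shows "lattice_series A e w * lattice_series B e' w' =
    lattice_series (A \<times> B) (\<lambda>(x, y). e x + e' y) (\<lambda>(x, y). w x * w' y)"
proof (rule fps_ext)
  fix n
  let ?A = "\<lambda>i. {x \<in> A. e x = int i}" and ?B = "\<lambda>i. {y \<in> B. e' y = int i}"
  have "{z \<in> A \<times> B. (case z of (x, y) \<Rightarrow> e x + e' y) = int n} = (\<Union>i\<in>{0..n}. ?A i \<times> ?B (n - i))"
  proof safe
    fix x y assume xy: "x \<in> A" "y \<in> B" "e x + e' y = int n"
    have "0 \<le> e x" "0 \<le> e' y"
      using xy assms by (auto simp: locally_finite_def)
    hence "nat (e x) \<in> {0..n}" "(x, y) \<in> ?A (nat (e x)) \<times> ?B (n - nat (e x))"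
      using xy by auto
    thus "(x, y) \<in> (\<Union>i\<in>{0..n}. ?A i \<times> ?B (n - i))"
      by blast
  qed (auto simp: of_nat_diff)
  hence "fps_nth (lattice_series (A \<times> B) (\<lambda>(x, y). e x + e' y) (\<lambda>(x, y). w x * w' y)) n =
      (\<Sum>z\<in>(\<Union>i\<in>{0..n}. ?A i \<times> ?B (n - i)). case z of (x, y) \<Rightarrow> w x * w' y)"
    by (simp add: lattice_series_def)
  also have "\<dots> = (\<Sum>i=0..n. \<Sum>z\<in>?A i \<times> ?B (n - i). case z of (x, y) \<Rightarrow> w x * w' y)"
  proof (rule sum.UNION_disjoint)
    show "\<forall>i\<in>{0..n}. finite (?A i \<times> ?B (n - i))"
      using assms by (simp add: locally_finite_def)
  qed auto
  also have "\<dots> = (\<Sum>i=0..n. sum w (?A i) * sum w' (?B (n - i)))"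
    by (simp add: sum_product sum.cartesian_product)
  finally show "fps_nth (lattice_series A e w * lattice_series B e' w') n =
      fps_nth (lattice_series (A \<times> B) (\<lambda>(x, y). e x + e' y) (\<lambda>(x, y). w x * w' y)) n"
    by (simp add: lattice_series_def fps_mult_nth)
qed

lemma lattice_series_reindex:
  assumes "bij_betw f A B" "\<And>x. x \<in> A \<Longrightarrow> e' (f x) = e x" "\<And>x. x \<in> A \<Longrightarrow> w' (f x) = w x"
  shows "lattice_series A e w = lattice_series B e' w'"
proof (rule fps_ext)
  fix n
  have "bij_betw f {x \<in> A. e x = int n} {x \<in> B. e' x = int n}"
    using assms(1,2) by (auto simp: bij_betw_def inj_on_def)
  from sum.reindex_bij_betw[OF this, of w']
  show "fps_nth (lattice_series A e w) n = fps_nth (lattice_series B e' w') n"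
    using assms(3) by (simp add: lattice_series_def)
qed

lemma lattice_series_Un:
  assumes "locally_finite (A \<union> B) e" "A \<inter> B = {}"
  shows "lattice_series (A \<union> B) e w = lattice_series A e w + lattice_series B e w"
proof (rule fps_ext)
  fix n
  have "{x \<in> A \<union> B. e x = int n} = {x \<in> A. e x = int n} \<union> {x \<in> B. e x = int n}"
    by auto
  moreover have "finite {x \<in> A. e x = int n}" "finite {x \<in> B. e x = int n}"
    using locally_finite_subset[OF assms(1), of A] locally_finite_subset[OF assms(1), of B]
    by (auto simp: locally_finite_def)
  ultimately show "fps_nth (lattice_series (A \<union> B) e w) n = fps_nth (lattice_series A e w + lattice_series B e w) n"
    using assms(2) by (auto simp: lattice_series_def intro!: sum.union_disjoint)
qed

text \<open>Nonnegativity of \<open>e\<close> matters: \<open>lattice_series\<close> discards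
  negative exponents, which the shift could bring back.\<close>

lemma lattice_series_shift:
  assumes "\<And>x. x \<in> A \<Longrightarrow> 0 \<le> e x"
  shows "fps_X ^ k * lattice_series A e w = lattice_series A (\<lambda>x. e x + int k) w"
proof (rule fps_ext)
  fix n
  have "e x + int k = int n \<longleftrightarrow> \<not> n < k \<and> e x = int (n - k)" if "x \<in> A" for x
    using assms[OF that] by auto
  hence "{x \<in> A. e x + int k = int n} = (if n < k then {} else {x \<in> A. e x = int (n - k)})"
    by auto
  thus "fps_nth (fps_X ^ k * lattice_series A e w) n = fps_nth (lattice_series A (\<lambda>x. e x + int k) w) n"
    by (simp add: lattice_series_def fps_X_power_mult_nth)
qed

lemma lattice_series_const_mult:
  "fps_const c * lattice_series A e w = lattice_series A e (\<lambda>x. c * w x)"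
  by (rule fps_ext) (simp add: lattice_series_def sum_distrib_left)

lemma two_theta_exp: "2 * theta_exp i j n = int i * (n * (n + 1)) + int j * (n * (n - 1))"
proof -
  have "2 * theta_exp i j n = int i * (2 * tri n) + int j * (2 * tri (n - 1))"
    by (simp add: theta_exp_def)
  thus ?thesis
    by (simp only: two_tri) (simp add: mult.commute)
qed

text \<open>To cover \<open>theta d 0 1\<close>, the bound comes from \<open>tri n\<close> alone.
  The summand 1 in it is forced by \<open>tri (-1) = 0\<close>.\<close>

lemma locally_finite_theta_exp:
  assumes "i > 0"
  shows "locally_finite UNIV (theta_exp i j)"
proof -
  have nonneg: "0 \<le> theta_exp i j n" for n
    by (simp add: theta_exp_def tri_nonneg)
  have "\<bar>n\<bar> \<le> theta_exp i j n + 1" for n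
  proof -
    have "\<bar>n\<bar> \<le> tri n + 1"
      using tri_plus_1[of n] tri_plus_1[of "n - 1"] tri_nonneg[of "n - 1"] tri_nonneg[of "n + 1"] by simp
    moreover have "1 * tri n \<le> int i * tri n" "0 \<le> int j * tri (n - 1)"
      using assms by (intro mult_right_mono mult_nonneg_nonneg tri_nonneg; simp)+
    ultimately show ?thesis
      unfolding theta_exp_def by linarith
  qed
  hence "-(m + 1) \<le> n \<and> n \<le> m + 1" if "theta_exp i j n = m" for m n
    using \<open>\<And>n. \<bar>n\<bar> \<le> theta_exp i j n + 1\<close>[of n] that by linarith
  hence "{n. theta_exp i j n = m} \<subseteq> {-(m + 1)..m + 1}" for m
    by auto
  hence "finite {n. theta_exp i j n = m}" for m
    by (rule finite_subset) simp
  thus ?thesis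
    using nonneg by (simp add: locally_finite_def)
qed

lemma theta_mult:
  assumes "i > 0" "i' > 0"
  shows "theta i j s * theta i' j' s' = lattice_series UNIV (\<lambda>(m, n). theta_exp i j m + theta_exp i' j' n)
    (\<lambda>(m, n). parity_sign s m * parity_sign s' n)"
  unfolding theta_def using assms by (subst lattice_series_mult) (simp_all add: locally_finite_theta_exp)

lemma locally_finite_theta_exp_plus:
  assumes "i > 0" "i' > 0"
  shows "locally_finite UNIV (\<lambda>(m, n). theta_exp i j m + theta_exp i' j' n)"
  using locally_finite_Times[OF locally_finite_theta_exp[OF assms(1)] locally_finite_theta_exp[OF assms(2)]]
  by simp

lemma lattice_series_even_odd:
  fixes e :: "int \<Rightarrow> int"
  assumes "locally_finite UNIV e"
  shows "lattice_series UNIV e w = lattice_series UNIV (\<lambda>n. e (2 * n)) (\<lambda>n. w (2 * n)) +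
    lattice_series UNIV (\<lambda>n. e (2 * n + 1)) (\<lambda>n. w (2 * n + 1))"
proof -
  have "lattice_series UNIV e w = lattice_series (Collect even \<union> Collect odd) e w"
    by (rule arg_cong[where f = "\<lambda>A. lattice_series A e w"]) auto
  also have "\<dots> = lattice_series (Collect even) e w + lattice_series (Collect odd) e w"
    by (rule lattice_series_Un) (use locally_finite_subset[OF assms] in auto)
  moreover have "range (\<lambda>n. 2 * n) = Collect (even :: int \<Rightarrow> bool)"
    by (auto simp: dvd_def)
  hence "bij_betw (\<lambda>n. 2 * n) UNIV (Collect (even :: int \<Rightarrow> bool))"
    by (simp add: bij_betw_def inj_on_def)
  hence "lattice_series (Collect even) e w = lattice_series UNIV (\<lambda>n. e (2 * n)) (\<lambda>n. w (2 * n))"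
    by (rule lattice_series_reindex[symmetric]) simp_all
  moreover have "range (\<lambda>n. 2 * n + 1) = Collect (odd :: int \<Rightarrow> bool)"
    by (auto elim: oddE)
  hence "bij_betw (\<lambda>n. 2 * n + 1) UNIV (Collect (odd :: int \<Rightarrow> bool))"
    by (simp add: bij_betw_def inj_on_def)
  hence "lattice_series (Collect odd) e w = lattice_series UNIV (\<lambda>n. e (2 * n + 1)) (\<lambda>n. w (2 * n + 1))"
    by (rule lattice_series_reindex[symmetric]) simp_all
  ultimately show ?thesis
    by (simp only:)
qed

text \<open>The pairs with even sum form the index-2 sublattice of all
  \<open>(a + b, a - b)\<close>, and those with odd sum are its other coset.\<close>

lemma lattice_series_parity_rotate:
  fixes e :: "int \<times> int \<Rightarrow> int"
  assumes "locally_finite UNIV e"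
  shows "lattice_series UNIV e w =
    lattice_series UNIV (\<lambda>(a, b). e (a + b, a - b)) (\<lambda>(a, b). w (a + b, a - b)) +
    lattice_series UNIV (\<lambda>(a, b). e (a + b + 1, a - b)) (\<lambda>(a, b). w (a + b + 1, a - b))"
proof -
  let ?A = "{(m, n). even (m + n)} :: (int \<times> int) set" and ?B = "{(m, n). odd (m + n)} :: (int \<times> int) set"
  have "lattice_series UNIV e w = lattice_series (?A \<union> ?B) e w"
    by (rule arg_cong[where f = "\<lambda>A. lattice_series A e w"]) auto
  also have "\<dots> = lattice_series ?A e w + lattice_series ?B e w"
    by (rule lattice_series_Un) (use locally_finite_subset[OF assms] in auto)
  also have "lattice_series ?A e w = lattice_series UNIV (\<lambda>(a, b). e (a + b, a - b)) (\<lambda>(a, b). w (a + b, a - b))"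
  proof (rule lattice_series_reindex[symmetric, where f = "\<lambda>(a, b). (a + b, a - b)"])
    have "(m, n) \<in> range (\<lambda>(a, b). (a + b, a - b))" if "even (m + n)" for m n :: int
    proof -
      from that obtain k where "m + n = 2 * k"
        by (elim evenE)
      hence "(m, n) = (k + (m - k), k - (m - k))"
        by simp
      thus ?thesis
        by (intro image_eqI[of _ _ "(k, m - k)"]) auto
    qed
    thus "bij_betw (\<lambda>(a, b). (a + b, a - b)) UNIV ?A"
      by (auto simp: bij_betw_def inj_on_def)
  qed auto
  also have "lattice_series ?B e w = lattice_series UNIV (\<lambda>(a, b). e (a + b + 1, a - b)) (\<lambda>(a, b). w (a + b + 1, a - b))"
  proof (rule lattice_series_reindex[symmetric, where f = "\<lambda>(a, b). (a + b + 1, a - b)"])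
    have "(m, n) \<in> range (\<lambda>(a, b). (a + b + 1, a - b))" if "odd (m + n)" for m n :: int
    proof -
      from that obtain k where "m + n = 2 * k + 1"
        by (elim oddE)
      hence "(m, n) = (k + (m - 1 - k) + 1, k - (m - 1 - k))"
        by simp
      thus ?thesis
        by (intro image_eqI[of _ _ "(k, m - 1 - k)"]) auto
    qed
    thus "bij_betw (\<lambda>(a, b). (a + b + 1, a - b)) UNIV ?B"
      by (auto simp: bij_betw_def inj_on_def)
  qed auto
  finally show ?thesis .
qed

lemma parity_sign_1: "parity_sign 1 = (\<lambda>n. 1)"
  by (auto simp: parity_sign_def)

lemma parity_sign_even: "parity_sign s (2 * n) = 1"
  and parity_sign_odd: "parity_sign s (2 * n + 1) = s"
  by (simp_all add: parity_sign_def)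

text \<open>On both cosets of the parity rotation the exponent separates into a part in
  \<open>a\<close> and a part in \<open>b\<close>, while the sign is 1 on one coset and
  \<open>s\<close> on the other. Thus \<open>s = 1\<close> and \<open>s = -1\<close> give the sum
  and the difference of the same two series.\<close>

lemma theta_14_23:
  assumes "s = 1 \<or> s = -1"
  shows "theta 1 4 s * theta 2 3 s =
    theta 3 7 1 * theta 4 6 1 + fps_const s * (fps_X * (theta 8 2 1 * theta 9 1 1))"
proof -
  have "theta 8 2 1 * theta 9 1 1 = lattice_series UNIV (\<lambda>(m, n). theta_exp 8 2 m + theta_exp 9 1 n) (\<lambda>(m, n). 1)"
    by (subst theta_mult) (simp_all add: parity_sign_1)
  hence "fps_const s * (fps_X ^ 1 * (theta 8 2 1 * theta 9 1 1)) =
    lattice_series UNIV (\<lambda>(a, b). theta_exp 8 2 a + theta_exp 9 1 b + 1) (\<lambda>(a, b). s)"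
    by (simp only:, subst lattice_series_shift)
      (auto simp: lattice_series_const_mult case_prod_unfold theta_exp_def tri_nonneg)
  moreover have "theta 3 7 1 * theta 4 6 1 = lattice_series UNIV (\<lambda>(m, n). theta_exp 3 7 m + theta_exp 4 6 n) (\<lambda>(m, n). 1)"
    by (subst theta_mult) (simp_all add: parity_sign_1)
  moreover have "theta_exp 1 4 (a + b) + theta_exp 2 3 (a - b) = theta_exp 3 7 a + theta_exp 4 6 b" for a b
  proof -
    have "2 * (theta_exp 1 4 (a + b) + theta_exp 2 3 (a - b)) = 2 * (theta_exp 3 7 a + theta_exp 4 6 b)"
      unfolding distrib_left[of 2] two_theta_exp by (simp add: algebra_simps)
    thus ?thesis by simp
  qed
  moreover have "theta_exp 1 4 (a + b + 1) + theta_exp 2 3 (a - b) = theta_exp 8 2 a + theta_exp 9 1 b + 1" for a b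
  proof -
    have "2 * (theta_exp 1 4 (a + b + 1) + theta_exp 2 3 (a - b)) = 2 * (theta_exp 8 2 a + theta_exp 9 1 b + 1)"
      unfolding distrib_left[of 2] two_theta_exp by (simp add: algebra_simps)
    thus ?thesis by simp
  qed
  moreover have "parity_sign s (a + b) * parity_sign s (a - b) = 1"
    "parity_sign s (a + b + 1) * parity_sign s (a - b) = s" for a b
    using assms by (auto simp: parity_sign_def)
  moreover have "theta 1 4 s * theta 2 3 s = lattice_series UNIV (\<lambda>(m, n). theta_exp 1 4 m + theta_exp 2 3 n)
      (\<lambda>(m, n). parity_sign s m * parity_sign s n)"
    by (rule theta_mult) simp_all
  moreover note lattice_series_parity_rotate[OF locally_finite_theta_exp_plus[of 1 2 4 3],
      of "\<lambda>(m, n). parity_sign s m * parity_sign s n"]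
  ultimately show ?thesis
    by (simp only: prod.case power_one_right zero_less_numeral zero_less_one simp_thms)
qed

text \<open>In classical form, \<phi>(s q)^2 = \<phi>(q^2)^2 + 4 s q \<psi>(q^4)^2, again by the
  parity rotation.\<close>

lemma theta_diag_square:
  assumes "d > 0" "s = 1 \<or> s = -1"
  shows "(theta d d s)\<^sup>2 = (theta (2*d) (2*d) 1)\<^sup>2 + fps_const s * (fps_X ^ d * (theta (4*d) 0 1)\<^sup>2)"
proof -
  have "(theta (4*d) 0 1)\<^sup>2 = lattice_series UNIV (\<lambda>(m, n). theta_exp (4*d) 0 m + theta_exp (4*d) 0 n) (\<lambda>(m, n). 1)"
    unfolding power2_eq_square using assms(1) by (subst theta_mult) (simp_all add: parity_sign_1)
  hence "fps_const s * (fps_X ^ d * (theta (4*d) 0 1)\<^sup>2) =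
    lattice_series UNIV (\<lambda>(a, b). theta_exp (4*d) 0 a + theta_exp (4*d) 0 b + int d) (\<lambda>(a, b). s)"
    by (simp only:, subst lattice_series_shift)
      (auto simp: lattice_series_const_mult case_prod_unfold theta_exp_def tri_nonneg)
  moreover have "theta_exp d d (a + b) + theta_exp d d (a - b) = theta_exp (2*d) (2*d) a + theta_exp (2*d) (2*d) b" for a b
  proof -
    have "2 * (theta_exp d d (a + b) + theta_exp d d (a - b)) = 2 * (theta_exp (2*d) (2*d) a + theta_exp (2*d) (2*d) b)"
      unfolding distrib_left[of 2] two_theta_exp by (simp add: algebra_simps)
    thus ?thesis by simp
  qed
  moreover have "theta_exp d d (a + b + 1) + theta_exp d d (a - b) = theta_exp (4*d) 0 a + theta_exp (4*d) 0 b + int d" for a b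
  proof -
    have "2 * (theta_exp d d (a + b + 1) + theta_exp d d (a - b)) = 2 * (theta_exp (4*d) 0 a + theta_exp (4*d) 0 b + int d)"
      unfolding distrib_left[of 2] two_theta_exp by (simp add: algebra_simps)
    thus ?thesis by simp
  qed
  moreover have "parity_sign s (a + b) * parity_sign s (a - b) = 1"
    "parity_sign s (a + b + 1) * parity_sign s (a - b) = s" for a b
    using assms by (auto simp: parity_sign_def)
  moreover have "(theta d d s)\<^sup>2 = lattice_series UNIV (\<lambda>(m, n). theta_exp d d m + theta_exp d d n)
     (\<lambda>(m, n). parity_sign s m * parity_sign s n)"
    "(theta (2*d) (2*d) 1)\<^sup>2 = lattice_series UNIV (\<lambda>(m, n). theta_exp (2*d) (2*d) m + theta_exp (2*d) (2*d) n) (\<lambda>(m, n). 1)"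
    using assms(1) by (simp_all add: power2_eq_square theta_mult parity_sign_def)
  moreover note lattice_series_parity_rotate[OF locally_finite_theta_exp_plus[OF assms(1) assms(1), of d d],
      of "\<lambda>(m, n). parity_sign s m * parity_sign s n"]
  ultimately show ?thesis
    by (simp only: prod.case)
qed

text \<open>In classical form, \<phi>(s q) = \<phi>(q^4) + 2 s q \<psi>(q^8): even and odd
  squares.\<close>

lemma theta_diag_even_odd:
  assumes "d > 0"
  shows "theta d d s = theta (4*d) (4*d) 1 + fps_const s * (fps_X ^ d * theta (8*d) 0 1)"
proof -
  have "theta_exp d d (2 * n) = theta_exp (4*d) (4*d) n" for n
    using two_theta_exp[of d d "2 * n"] two_theta_exp[of "4*d" "4*d" n] by (simp add: algebra_simps)
  moreover have "theta_exp d d (2 * n + 1) = theta_exp (8*d) 0 n + int d" for n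
    using two_theta_exp[of d d "2 * n + 1"] two_theta_exp[of "8*d" 0 n] by (simp add: algebra_simps)
  moreover have "fps_const s * (fps_X ^ d * theta (8*d) 0 1) =
      lattice_series UNIV (\<lambda>n. theta_exp (8*d) 0 n + int d) (\<lambda>n. s)"
    unfolding theta_def
    by (subst lattice_series_shift)
      (auto simp: lattice_series_const_mult parity_sign_def theta_exp_def tri_nonneg)
  ultimately show ?thesis
    unfolding theta_def[of d d] theta_def[of "4*d" "4*d"] using assms
    by (subst lattice_series_even_odd) (simp_all add: locally_finite_theta_exp parity_sign_1 parity_sign_even parity_sign_odd)
qed

text \<open>Since \<open>n\<close> and \<open>- n - 1\<close> have the same triangular number, each
  exponent is counted twice; even and odd indices supply one copy of \<psi> each.\<close>

lemma theta_triangular: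
  assumes "d > 0"
  shows "theta d 0 1 = 2 * theta d (3*d) 1"
proof -
  have "theta_exp d 0 (2 * n) = theta_exp d (3*d) (-n)" for n
    using two_theta_exp[of d 0 "2 * n"] two_theta_exp[of d "3*d" "-n"] by (simp add: algebra_simps)
  moreover have "theta_exp d 0 (2 * n + 1) = theta_exp d (3*d) (n + 1)" for n
    using two_theta_exp[of d 0 "2 * n + 1"] two_theta_exp[of d "3*d" "n + 1"] by (simp add: algebra_simps)
  moreover have "lattice_series UNIV (\<lambda>n. theta_exp d (3*d) (-n)) (\<lambda>n. 1) = theta d (3*d) 1"
    unfolding theta_def by (rule lattice_series_reindex[where f = uminus]) (auto simp: parity_sign_def bij_uminus)
  moreover have "lattice_series UNIV (\<lambda>n. theta_exp d (3*d) (n + 1)) (\<lambda>n. 1) = theta d (3*d) 1"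
    unfolding theta_def by (rule lattice_series_reindex[where f = "\<lambda>n. n + 1"]) (auto simp: parity_sign_def bij_plus_right)
  ultimately show ?thesis
    unfolding theta_def[of d 0] using assms
    by (subst lattice_series_even_odd) (simp_all add: locally_finite_theta_exp parity_sign_def)
qed

section \<open>Two quadratic form identities\<close>

lemma int_mod_eqI:
  fixes x d k r :: int
  assumes "x = d * k + r" "0 \<le> r" "r < d"
  shows "x mod d = r"
  using assms by simp

lemma int_mod_eqE:
  fixes x d r :: int
  assumes "x mod d = r"
  obtains k where "x = d * k + r"
  using assms mult_div_mod_eq[of d x] by metis

text \<open>
  In the coordinates \<open>(2u+1) + (2v+1) i\<close> of Gaussian integers, the class of \<open>u - 2v\<close> modulo 5 distinguishes
  the residues modulo \<open>2 + i\<close>. Multiplication by \<open>i\<close> permutes the four nonzero residues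
  cyclically, and the multiples of \<open>2 + i\<close> (class 3) contribute the same series in \<open>q^5\<close>.
\<close>

lemma lattice_series_rotate:
  assumes "\<And>x :: int. (- 2 * x - 1) mod 5 = c' \<longleftrightarrow> x mod 5 = c"
  shows "lattice_series {(u, v). (u - 2 * v) mod 5 = c} (\<lambda>(u, v). tri u + tri v) (\<lambda>_. 1) =
    lattice_series {(u, v). (u - 2 * v) mod 5 = c'} (\<lambda>(u, v). tri u + tri v) (\<lambda>_. 1)"
\<comment> \<open>This is multiplication of \<open>(2u+1) + (2v+1) i\<close> by \<open>i\<close>; it
  sends class \<open>c\<close> to \<open>- 2 c - 1\<close>.\<close>
proof (rule lattice_series_reindex[where f = "\<lambda>(u, v). (- v - 1, u)"])
  have rot: "(- v - 1 - 2 * u) mod 5 = c' \<longleftrightarrow> (u - 2 * v) mod 5 = c" for u v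
  proof -
    have "- v - 1 - 2 * u = - 2 * (u - 2 * v) - 1 + 5 * (- v)"
      by simp
    thus ?thesis
      by (simp only: mod_mult_self2 assms)
  qed
  have "(u, v) \<in> (\<lambda>(u, v). (- v - 1, u)) ` {(u, v). (u - 2 * v) mod 5 = c}" if "(u - 2 * v) mod 5 = c'" for u v
    using that rot[where u = v and v = "- u - 1"] by (intro image_eqI[of _ _ "(v, - u - 1)"]) auto
  thus "bij_betw (\<lambda>(u, v). (- v - 1, u)) {(u, v). (u - 2 * v) mod 5 = c} {(u, v). (u - 2 * v) mod 5 = c'}"
    using rot by (auto simp: bij_betw_def inj_on_def)
  fix x :: "int \<times> int"
  have "tri (- v - 1) = tri v" for v
    by (simp add: tri_def algebra_simps)
  thus "(case (case x of (u, v) \<Rightarrow> (- v - 1, u)) of (u, v) \<Rightarrow> tri u + tri v) = (case x of (u, v) \<Rightarrow> tri u + tri v)"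
    by (cases x) simp
qed simp

text \<open>The classes 0, 4, 1, 2 form one cycle under the rotation, so each contributes the same
  product of theta series; class 3 supplies the last term.\<close>

lemma theta_1_0_square: "(theta 1 0 1)\<^sup>2 = 4 * (theta 1 4 1 * theta 2 3 1) + fps_X * (theta 5 0 1)\<^sup>2"
proof -
  let ?e = "\<lambda>(u, v). tri u + tri v" and ?C = "\<lambda>c. {(u :: int, v :: int). (u - 2 * v) mod 5 = c}"
  let ?L = "\<lambda>A. lattice_series A ?e (\<lambda>_. 1)"
  have sq: "(theta 1 0 1)\<^sup>2 = ?L UNIV"
    unfolding power2_eq_square by (subst theta_mult) (simp_all add: parity_sign_1 theta_exp_def case_prod_unfold)
  have lf: "locally_finite A ?e" for A
    using locally_finite_subset[OF locally_finite_theta_exp_plus[of 1 1 0 0], of A]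
    by (simp add: theta_exp_def)
  have UNIV_eq: "(UNIV :: (int \<times> int) set) = ?C 0 \<union> (?C 1 \<union> (?C 2 \<union> (?C 4 \<union> ?C 3)))"
  proof -
    have "i mod 5 = 0 \<or> i mod 5 = 1 \<or> i mod 5 = 2 \<or> i mod 5 = 4 \<or> i mod 5 = 3" for i :: int
      by presburger
    thus ?thesis by auto
  qed
  have "?L UNIV = ?L (?C 0) + (?L (?C 1) + (?L (?C 2) + (?L (?C 4) + ?L (?C 3))))"
    by (subst UNIV_eq, (subst lattice_series_Un[OF lf], force)+) simp
  also have "?L (?C 0) = ?L (?C 4)"
    by (rule lattice_series_rotate) presburger
  also have "?L (?C 4) = ?L (?C 1)"
    by (rule lattice_series_rotate) presburger
  also have "?L (?C 1) = ?L (?C 2)"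
    by (rule lattice_series_rotate) presburger
  also have "?L (?C 2) = theta 1 4 1 * theta 2 3 1"
  proof -
    have "theta 1 4 1 * theta 2 3 1 = lattice_series UNIV (\<lambda>(m, n). theta_exp 1 4 m + theta_exp 2 3 n) (\<lambda>_. 1)"
      by (subst theta_mult) (simp_all add: parity_sign_1 case_prod_unfold)
    also have "\<dots> = ?L (?C 2)"
    \<comment> \<open>The linear part is multiplication of \<open>m + n i\<close> by
      \<open>-1 + 2 i = i (2 + i)\<close>. Its determinant is 5, so the image is exactly one
      class.\<close>
    proof (rule lattice_series_reindex[where f = "\<lambda>(m, n). (- m - 2 * n, 2 * m - n - 1)"])
      have "(u, v) \<in> range (\<lambda>(m, n). (- m - 2 * n, 2 * m - n - 1))" if "(u - 2 * v) mod 5 = 2" for u v :: int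
      proof -
        from that obtain k where "u - 2 * v = 5 * k + 2"
          by (rule int_mod_eqE)
        thus ?thesis
          by (intro image_eqI[of _ _ "(- k, - v - 2 * k - 1)"]) auto
      qed
      moreover have "(- m - 2 * n - 2 * (2 * m - n - 1)) mod 5 = 2" for m n :: int
        by (rule int_mod_eqI[of _ _ "- m"]) simp_all
      ultimately show "bij_betw (\<lambda>(m, n). (- m - 2 * n, 2 * m - n - 1)) UNIV (?C 2)"
        by (auto simp: bij_betw_def inj_on_def)
      fix x :: "int \<times> int"
      have "tri (- m - 2 * n) + tri (2 * m - n - 1) = theta_exp 1 4 m + theta_exp 2 3 n" for m n
      proof -
        have "2 * (tri (- m - 2 * n) + tri (2 * m - n - 1)) = 2 * (theta_exp 1 4 m + theta_exp 2 3 n)"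
          unfolding distrib_left[of 2] two_theta_exp two_tri by (simp add: algebra_simps)
        thus ?thesis by simp
      qed
      thus "?e (case x of (m, n) \<Rightarrow> (- m - 2 * n, 2 * m - n - 1)) = (case x of (m, n) \<Rightarrow> theta_exp 1 4 m + theta_exp 2 3 n)"
        by (cases x) simp
    qed simp
    finally show ?thesis ..
  qed
  also have "?L (?C 3) = fps_X * (theta 5 0 1)\<^sup>2"
  proof -
    have "(theta 5 0 1)\<^sup>2 = lattice_series UNIV (\<lambda>(s, t). theta_exp 5 0 s + theta_exp 5 0 t) (\<lambda>_. 1)"
      unfolding power2_eq_square by (subst theta_mult) (simp_all add: parity_sign_1 case_prod_unfold)
    hence "fps_X ^ 1 * (theta 5 0 1)\<^sup>2 = lattice_series UNIV (\<lambda>(s, t). theta_exp 5 0 s + theta_exp 5 0 t + 1) (\<lambda>_. 1)"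
      by (simp only:, subst lattice_series_shift) (auto simp: case_prod_unfold theta_exp_def tri_nonneg)
    also have "\<dots> = ?L (?C 3)"
    \<comment> \<open>Multiplication of \<open>(2s+1) + (2t+1) i\<close> by \<open>2 + i\<close>.
      The norm 5 gives \<open>tri u + tri v = 5 (tri s + tri t) + 1\<close>.\<close>
    proof (rule lattice_series_reindex[where f = "\<lambda>(s, t). (2 * s - t, s + 2 * t + 1)"])
      have "(u, v) \<in> range (\<lambda>(s, t). (2 * s - t, s + 2 * t + 1))" if "(u - 2 * v) mod 5 = 3" for u v :: int
      proof -
        from that obtain k where "u - 2 * v = 5 * k + 3"
          by (rule int_mod_eqE)
        thus ?thesis
          by (intro image_eqI[of _ _ "(v + 2 * k + 1, - k - 1)"]) auto
      qed
      moreover have "(2 * s - t - 2 * (s + 2 * t + 1)) mod 5 = 3" for s t :: int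
        by (rule int_mod_eqI[of _ _ "- t - 1"]) simp_all
      ultimately show "bij_betw (\<lambda>(s, t). (2 * s - t, s + 2 * t + 1)) UNIV (?C 3)"
        by (auto simp: bij_betw_def inj_on_def)
      fix x :: "int \<times> int"
      have "tri (2 * s - t) + tri (s + 2 * t + 1) = theta_exp 5 0 s + theta_exp 5 0 t + 1" for s t
      proof -
        have "2 * (tri (2 * s - t) + tri (s + 2 * t + 1)) = 2 * (theta_exp 5 0 s + theta_exp 5 0 t + 1)"
          unfolding distrib_left[of 2] two_theta_exp two_tri by (simp add: algebra_simps)
        thus ?thesis by simp
      qed
      thus "?e (case x of (s, t) \<Rightarrow> (2 * s - t, s + 2 * t + 1)) = (case x of (s, t) \<Rightarrow> theta_exp 5 0 s + theta_exp 5 0 t + 1)"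
        by (cases x) simp
    qed simp
    finally show ?thesis by simp
  qed
  finally show ?thesis
    unfolding sq by simp
qed

text \<open>
  The right-hand side is the sum of \<open>(-1)^v q^(d (u^2 + 5 v^2 - 1) / 4)\<close> over odd \<open>u + v\<close>. Its part with
  \<open>u + v\<close> prime to 3 is the left-hand side, whose summation indices satisfy
  \<open>(6m - 1) + (6n - 1) sqrt(-5) = (u + v sqrt(-5)) (1 + sqrt(-5))\<close> up to sign.
  Where \<open>u + v = 3 k\<close> the terms cancel under \<open>v \<mapsto> k - v\<close>.
\<close>

lemma theta_pentagonal_product:
  assumes d: "d > 0"
  shows "2 * (theta d (2*d) (-1) * theta (5*d) (10*d) (-1)) =
    theta (2*d) 0 1 * theta (5*d) (5*d) 1 - fps_X ^ d * (theta d d 1 * theta (10*d) 0 1)"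
proof -
  define e where "e = (\<lambda>(u, v). int d * ((u * u + 5 * v * v - 1) div 4))"
  define w where "w = (\<lambda>(u :: int, v). parity_sign (-1) v)"
  let ?O = "{(u :: int, v :: int). odd (u + v)}"
  let ?C = "\<lambda>c. {(u :: int, v :: int). (u + v) mod 6 = c}"
  \<comment> \<open>The division by 4 in \<open>e\<close> is exact: one of \<open>u\<close>,
    \<open>v\<close> is odd and the other even, so \<open>u^2 + 5 v^2\<close> is 1 modulo 4.\<close>
  have e4: "4 * ((u * u + 5 * v * v - 1) div 4) = u * u + 5 * v * v - 1" if "odd (u + v)" for u v :: int
  proof (rule dvd_mult_div_cancel)
    show "4 dvd u * u + 5 * v * v - 1"
    proof (cases "odd u")
      case True
      with that obtain a b where "u = 2 * a + 1" "v = 2 * b"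
        by (auto elim!: oddE evenE)
      hence "u * u + 5 * v * v - 1 = 4 * (a * a + a + 5 * b * b)"
        by (simp add: algebra_simps)
      thus ?thesis by simp
    next
      case False
      with that obtain a b where "u = 2 * a" "v = 2 * b + 1"
        by (auto elim!: oddE evenE)
      hence "u * u + 5 * v * v - 1 = 4 * (a * a + 5 * b * b + 5 * b + 1)"
        by (simp add: algebra_simps)
      thus ?thesis by simp
    qed
  qed
  have e_eqI: "e (u, v) = k" if "odd (u + v)" "int d * (u * u + 5 * v * v - 1) = 4 * k" for u v k
  proof -
    have "4 * e (u, v) = int d * (4 * ((u * u + 5 * v * v - 1) div 4))"
      by (simp add: e_def)
    also have "\<dots> = 4 * k"
      by (simp only: e4[OF that(1)] that(2))
    finally show ?thesis by simp
  qed
  have lf: "locally_finite A e" if "A \<subseteq> ?O" for A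
  proof (rule locally_finite_subset[OF _ that])
    have bound: "0 \<le> e (u, v) \<and> \<bar>u\<bar> \<le> 4 * e (u, v) + 1 \<and> \<bar>v\<bar> \<le> 4 * e (u, v) + 1" if "odd (u + v)" for u v
    proof -
      have abs_le: "\<bar>n\<bar> \<le> n * n" for n :: int
        using abs_le_tri[of n] two_tri[of n] two_tri[of "n - 1"] by (simp add: algebra_simps)
      define k where "k = (u * u + 5 * v * v - 1) div 4"
      have "1 \<le> \<bar>u\<bar> \<or> 1 \<le> \<bar>v\<bar>"
        using that by presburger
      moreover have "u * u + 5 * (v * v) = 4 * k + 1"
        using e4[OF that] by (simp add: k_def mult.assoc)
      ultimately have "0 \<le> k" "\<bar>u\<bar> \<le> 4 * k + 1" "\<bar>v\<bar> \<le> 4 * k + 1"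
        using abs_le[of u] abs_le[of v] by linarith+
      moreover from \<open>0 \<le> k\<close> have "1 * k \<le> int d * k"
        using d by (intro mult_right_mono) auto
      ultimately show ?thesis
        by (auto simp: e_def k_def)
    qed
    have "finite {x \<in> ?O. e x = n}" for n
    proof (rule finite_subset)
      show "{x \<in> ?O. e x = n} \<subseteq> {-(4 * n + 1)..4 * n + 1} \<times> {-(4 * n + 1)..4 * n + 1}"
      proof
        fix x assume x: "x \<in> {x \<in> ?O. e x = n}"
        then obtain u v where uv: "x = (u, v)" "odd (u + v)" "e (u, v) = n"
          by auto
        thus "x \<in> {-(4 * n + 1)..4 * n + 1} \<times> {-(4 * n + 1)..4 * n + 1}"
          using bound[OF uv(2)] by auto
      qed
    qed simp
    thus "locally_finite ?O e"
      using bound by (auto simp: locally_finite_def)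
  qed
  have "odd x \<longleftrightarrow> x mod 6 = 1 \<or> x mod 6 = 3 \<or> x mod 6 = 5" for x :: int
    by presburger
  hence O_eq: "?O = ?C 1 \<union> (?C 3 \<union> ?C 5)"
    by (simp only:) blast
  have 1: "theta (2*d) 0 1 * theta (5*d) (5*d) 1 = lattice_series {(u, v). odd u \<and> even v} e w"
  proof -
    have "theta (2*d) 0 1 * theta (5*d) (5*d) 1 =
        lattice_series UNIV (\<lambda>(a, b). theta_exp (2*d) 0 a + theta_exp (5*d) (5*d) b) (\<lambda>_. 1)"
      using d by (subst theta_mult) (simp_all add: parity_sign_1 case_prod_unfold)
    also have "\<dots> = lattice_series {(u, v). odd u \<and> even v} e w"
    proof (rule lattice_series_reindex[where f = "\<lambda>(a, b). (2 * a + 1, 2 * b)"])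
      have "(u, v) \<in> range (\<lambda>(a, b). (2 * a + 1, 2 * b))" if "odd u \<and> even v" for u v :: int
        using that by (intro image_eqI[of _ _ "(u div 2, v div 2)"]) auto
      thus "bij_betw (\<lambda>(a, b). (2 * a + 1, 2 * b)) UNIV {(u :: int, v :: int). odd u \<and> even v}"
        by (auto simp: bij_betw_def inj_on_def)
      fix x :: "int \<times> int"
      have "e (2 * a + 1, 2 * b) = theta_exp (2*d) 0 a + theta_exp (5*d) (5*d) b" for a b
        using two_theta_exp[of "2*d" 0 a] two_theta_exp[of "5*d" "5*d" b]
        by (intro e_eqI) (simp_all add: algebra_simps)
      thus "e (case x of (a, b) \<Rightarrow> (2 * a + 1, 2 * b)) = (case x of (a, b) \<Rightarrow> theta_exp (2*d) 0 a + theta_exp (5*d) (5*d) b)"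
        by (cases x) simp
    qed (auto simp: w_def parity_sign_def)
    finally show ?thesis .
  qed
  have 2: "- (fps_X ^ d * (theta d d 1 * theta (10*d) 0 1)) = lattice_series {(u, v). even u \<and> odd v} e w"
  proof -
    have "theta d d 1 * theta (10*d) 0 1 =
        lattice_series UNIV (\<lambda>(a, b). theta_exp d d a + theta_exp (10*d) 0 b) (\<lambda>_. 1)"
      using d by (subst theta_mult) (simp_all add: parity_sign_1 case_prod_unfold)
    hence "fps_const (-1) * (fps_X ^ d * (theta d d 1 * theta (10*d) 0 1)) =
        lattice_series UNIV (\<lambda>(a, b). theta_exp d d a + theta_exp (10*d) 0 b + int d) (\<lambda>_. -1)"
      by (simp only:, subst lattice_series_shift)
        (auto simp: lattice_series_const_mult case_prod_unfold theta_exp_def tri_nonneg)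
    also have "\<dots> = lattice_series {(u, v). even u \<and> odd v} e w"
    proof (rule lattice_series_reindex[where f = "\<lambda>(a, b). (2 * a, 2 * b + 1)"])
      have "(u, v) \<in> range (\<lambda>(a, b). (2 * a, 2 * b + 1))" if "even u \<and> odd v" for u v :: int
        using that by (intro image_eqI[of _ _ "(u div 2, v div 2)"]) auto
      thus "bij_betw (\<lambda>(a, b). (2 * a, 2 * b + 1)) UNIV {(u :: int, v :: int). even u \<and> odd v}"
        by (auto simp: bij_betw_def inj_on_def)
      fix x :: "int \<times> int"
      have "e (2 * a, 2 * b + 1) = theta_exp d d a + theta_exp (10*d) 0 b + int d" for a b
        using two_theta_exp[of d d a] two_theta_exp[of "10*d" 0 b]
        by (intro e_eqI) (simp_all add: algebra_simps)
      thus "e (case x of (a, b) \<Rightarrow> (2 * a, 2 * b + 1)) = (case x of (a, b) \<Rightarrow> theta_exp d d a + theta_exp (10*d) 0 b + int d)"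
        by (cases x) simp
    qed (auto simp: w_def parity_sign_def)
    finally show ?thesis
      by (simp flip: fps_const_neg)
  qed
  have 3: "lattice_series (?C 5) e w = theta d (2*d) (-1) * theta (5*d) (10*d) (-1)"
  proof -
    have "theta d (2*d) (-1) * theta (5*d) (10*d) (-1) =
        lattice_series UNIV (\<lambda>(m, n). theta_exp d (2*d) m + theta_exp (5*d) (10*d) n)
          (\<lambda>(m, n). parity_sign (-1) m * parity_sign (-1) n)"
      using d by (intro theta_mult) simp_all
    also have "\<dots> = lattice_series (?C 5) e w"
    \<comment> \<open>Solves \<open>u - 5 v = 6 m - 1\<close> and \<open>u + v = 6 n - 1\<close>,
      that is, divides by \<open>1 + sqrt(-5)\<close>, which has norm 6.\<close>
    proof (rule lattice_series_reindex[where f = "\<lambda>(m, n). (m + 5 * n - 1, n - m)"])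
      have "(u, v) \<in> range (\<lambda>(m, n). (m + 5 * n - 1, n - m))" if "(u + v) mod 6 = 5" for u v :: int
      proof -
        from that obtain k where "u + v = 6 * k + 5"
          by (rule int_mod_eqE)
        thus ?thesis
          by (intro image_eqI[of _ _ "(k + 1 - v, k + 1)"]) auto
      qed
      moreover have "(m + 5 * n - 1 + (n - m)) mod 6 = 5" for m n :: int
        by (rule int_mod_eqI[of _ _ "n - 1"]) simp_all
      ultimately show "bij_betw (\<lambda>(m, n). (m + 5 * n - 1, n - m)) UNIV (?C 5)"
        by (auto simp: bij_betw_def inj_on_def)
      fix x :: "int \<times> int"
      have "e (m + 5 * n - 1, n - m) = theta_exp d (2*d) m + theta_exp (5*d) (10*d) n" for m n
        using two_theta_exp[of d "2*d" m] two_theta_exp[of "5*d" "10*d" n]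
        by (intro e_eqI) (simp_all add: algebra_simps)
      thus "e (case x of (m, n) \<Rightarrow> (m + 5 * n - 1, n - m)) = (case x of (m, n) \<Rightarrow> theta_exp d (2*d) m + theta_exp (5*d) (10*d) n)"
        by (cases x) simp
    qed (auto simp: w_def parity_sign_def)
    finally show ?thesis ..
  qed
  have 4: "lattice_series (?C 1) e w = lattice_series (?C 5) e w"
  proof (rule lattice_series_reindex[where f = "\<lambda>(u, v). (- u, - v)"])
    have neg: "(- x) mod 6 = 5 \<longleftrightarrow> x mod 6 = 1" "(- x) mod 6 = 1 \<longleftrightarrow> x mod 6 = 5" for x :: int
      by presburger+
    have *: "(- u - v) mod 6 = 5 \<longleftrightarrow> (u + v) mod 6 = 1" for u v :: int
      using neg(1)[of "u + v"] by simp
    have **: "(- v - u) mod 6 = 1 \<longleftrightarrow> (u + v) mod 6 = 5" for u v :: int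
    proof -
      have "- v - u = - (u + v)"
        by simp
      thus ?thesis
        by (simp only: neg)
    qed
    have "(u, v) \<in> (\<lambda>(u, v). (- u, - v)) ` ?C 1" if "(u + v) mod 6 = 5" for u v
      using that ** by (intro image_eqI[of _ _ "(- u, - v)"]) auto
    thus "bij_betw (\<lambda>(u, v). (- u, - v)) (?C 1) (?C 5)"
      using * by (auto simp: bij_betw_def inj_on_def)
  qed (auto simp: w_def e_def parity_sign_def)
  have 5: "lattice_series (?C 3) e w = 0"
  proof -
    let ?K = "{(k :: int, v :: int). odd k}"
    let ?e = "\<lambda>(k, v). e (3 * k - v, v)"
    have C3: "lattice_series (?C 3) e w = lattice_series ?K ?e w"
    proof (rule lattice_series_reindex[symmetric, where f = "\<lambda>(k, v). (3 * k - v, v)"])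
      have "(u, v) \<in> (\<lambda>(k, v). (3 * k - v, v)) ` ?K" if "(u + v) mod 6 = 3" for u v
      proof -
        from that obtain k where "u + v = 6 * k + 3"
          by (rule int_mod_eqE)
        thus ?thesis
          by (intro image_eqI[of _ _ "(2 * k + 1, v)"]) auto
      qed
      moreover have "(3 * k) mod 6 = 3" if "odd k" for k :: int
        using that by presburger
      ultimately show "bij_betw (\<lambda>(k, v). (3 * k - v, v)) ?K (?C 3)"
        by (auto simp: bij_betw_def inj_on_def)
    qed (auto simp: w_def)
    \<comment> \<open>The form \<open>(3k-v)^2 + 5 v^2 = 9 k^2 - 6 v (k-v)\<close> is invariant
      under exchanging \<open>v\<close> and \<open>k - v\<close>; as \<open>k\<close> is odd, this
      flips the parity of \<open>v\<close> and hence the sign.\<close>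
    have "lattice_series ?K ?e w = lattice_series ?K ?e (\<lambda>x. - w x)"
    proof (rule lattice_series_reindex[where f = "\<lambda>(k, v). (k, k - v)"])
      have "(k, v) \<in> (\<lambda>(k, v). (k, k - v)) ` ?K" if "odd k" for k v
        using that by (intro image_eqI[of _ _ "(k, k - v)"]) auto
      thus "bij_betw (\<lambda>(k, v). (k, k - v)) ?K ?K"
        by (auto simp: bij_betw_def inj_on_def)
    qed (auto simp: w_def e_def parity_sign_def algebra_simps)
    also have "\<dots> = - lattice_series ?K ?e w"
      by (rule fps_ext) (simp add: lattice_series_def sum_negf)
    finally have "lattice_series ?K ?e w = 0"
      by (simp add: fps_eq_iff)
    thus ?thesis
      by (simp only: C3)
  qed
  have "theta (2*d) 0 1 * theta (5*d) (5*d) 1 - fps_X ^ d * (theta d d 1 * theta (10*d) 0 1) =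
      lattice_series {(u, v). odd u \<and> even v} e w + lattice_series {(u, v). even u \<and> odd v} e w"
    using 1 2 by simp
  also have "\<dots> = lattice_series ({(u, v). odd u \<and> even v} \<union> {(u, v). even u \<and> odd v}) e w"
    by (rule lattice_series_Un[symmetric]) (auto intro!: lf)
  also have "{(u :: int, v :: int). odd u \<and> even v} \<union> {(u, v). even u \<and> odd v} = ?C 1 \<union> (?C 3 \<union> ?C 5)"
  proof -
    have "{(u :: int, v :: int). odd u \<and> even v} \<union> {(u, v). even u \<and> odd v} = ?O"
      by auto
    thus ?thesis
      by (simp only: O_eq)
  qed
  also have "lattice_series (?C 1 \<union> (?C 3 \<union> ?C 5)) e w = lattice_series (?C 1) e w + (lattice_series (?C 3) e w + lattice_series (?C 5) e w)"
  proof -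
    have lfC: "locally_finite (?C 1 \<union> (?C 3 \<union> ?C 5)) e" "locally_finite (?C 3 \<union> ?C 5) e"
      unfolding O_eq by (intro lf[unfolded O_eq]; blast)+
    thus ?thesis
      by (subst lattice_series_Un[OF lfC(1)], force, subst lattice_series_Un[OF lfC(2)], force) (rule refl)
  qed
  finally show ?thesis
    unfolding 3 4 5 by simp
qed

section \<open>Product evaluations of theta series\<close>

lemma eprod_disjoint_Un:
  "C = A \<union> B \<Longrightarrow> A \<inter> B = {} \<Longrightarrow> eprod s C = eprod s A * eprod s B"
  by (simp add: eprod_Un)

text \<open>Reduces the residue classes modulo \<open>c * d\<close> below to residues modulo
  \<open>c\<close> of \<open>k div d\<close>.\<close>

lemma mod_mult_eq_iff:
  fixes d :: nat
  assumes "d > 0"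
  shows "k mod (c * d) = r * d \<longleftrightarrow> d dvd k \<and> (k div d) mod c = r"
proof (cases "d dvd k")
  case True
  then obtain m where "k = m * d"
    by (metis dvd_def mult.commute)
  thus ?thesis
    using assms by (simp add: mult_mod_left)
next
  case False
  have "d dvd k" if "k mod (c * d) = r * d"
  proof -
    have "k = k div (c * d) * (c * d) + r * d"
      using div_mult_mod_eq[of k "c * d"] that by simp
    thus ?thesis
      by (metis dvd_add dvd_triv_right mult.assoc)
  qed
  thus ?thesis
    using False by blast
qed

lemma mult_dvd_iff:
  fixes d :: nat
  assumes "d > 0"
  shows "c * d dvd k \<longleftrightarrow> d dvd k \<and> (k div d) mod c = 0"
  using mod_mult_eq_iff[OF assms, of k c 0] by (simp add: dvd_eq_mod_eq_0)

lemma eprod_multiples_2: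
  assumes "d > 0"
  shows "eprod s {k. d dvd k} = eprod s {k. k mod (2*d) = d} * eprod s {k. 2*d dvd k}"
proof (rule eprod_disjoint_Un)
  have *: "k mod (2*d) = d \<longleftrightarrow> d dvd k \<and> (k div d) mod 2 = 1" for k
    using mod_mult_eq_iff[OF assms, of k 2 1] by simp
  show "{k. d dvd k} = {k. k mod (2*d) = d} \<union> {k. 2*d dvd k}"
    unfolding * mult_dvd_iff[OF assms] by auto
  show "{k. k mod (2*d) = d} \<inter> {k. 2*d dvd k} = {}"
    unfolding * mult_dvd_iff[OF assms] by auto
qed

lemma eprod_multiples_3:
  assumes "d > 0"
  shows "eprod s {k. d dvd k} = eprod s {k. k mod (3*d) = d} * (eprod s {k. k mod (3*d) = 2*d} * eprod s {k. 3*d dvd k})"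
proof -
  have *: "k mod (3*d) = d \<longleftrightarrow> d dvd k \<and> (k div d) mod 3 = 1" for k
    using mod_mult_eq_iff[OF assms, of k 3 1] by simp
  have cases: "n mod 3 = 1 \<or> n mod 3 = 2 \<or> n mod 3 = 0" for n :: nat
    by presburger
  have "eprod s {k. d dvd k} = eprod s {k. k mod (3*d) = d} * eprod s ({k. k mod (3*d) = 2*d} \<union> {k. 3*d dvd k})"
    unfolding * mult_dvd_iff[OF assms] mod_mult_eq_iff[OF assms]
    by (rule eprod_disjoint_Un) (use cases in auto)
  also have "eprod s ({k. k mod (3*d) = 2*d} \<union> {k. 3*d dvd k}) = eprod s {k. k mod (3*d) = 2*d} * eprod s {k. 3*d dvd k}"
    unfolding mult_dvd_iff[OF assms] mod_mult_eq_iff[OF assms]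
    by (rule eprod_Un) auto
  finally show ?thesis .
qed

lemma eprod_odd_multiples_4:
  assumes "d > 0"
  shows "eprod s {k. k mod (2*d) = d} = eprod s {k. k mod (4*d) = d} * eprod s {k. k mod (4*d) = 3*d}"
proof (rule eprod_disjoint_Un)
  have *: "k mod (c*d) = d \<longleftrightarrow> d dvd k \<and> (k div d) mod c = 1" for k c
    using mod_mult_eq_iff[OF assms, of k c 1] by simp
  have cases: "n mod 2 = 1 \<longleftrightarrow> n mod 4 = 1 \<or> n mod 4 = 3" for n :: nat
    by presburger
  show "{k. k mod (2*d) = d} = {k. k mod (4*d) = d} \<union> {k. k mod (4*d) = 3*d}"
    unfolding * mod_mult_eq_iff[OF assms] using cases by auto
  show "{k. k mod (4*d) = d} \<inter> {k. k mod (4*d) = 3*d} = {}"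
    using assms by auto
qed

lemma eprod_multiples_5:
  assumes "d > 0"
  shows "eprod s {k. d dvd k} = eprod s {k. k mod (5*d) = d} * (eprod s {k. k mod (5*d) = 2*d} *
    (eprod s {k. k mod (5*d) = 3*d} * (eprod s {k. k mod (5*d) = 4*d} * eprod s {k. 5*d dvd k})))"
proof -
  have *: "k mod (5*d) = d \<longleftrightarrow> d dvd k \<and> (k div d) mod 5 = 1" for k
    using mod_mult_eq_iff[OF assms, of k 5 1] by simp
  have cases: "n mod 5 = 1 \<or> n mod 5 = 2 \<or> n mod 5 = 3 \<or> n mod 5 = 4 \<or> n mod 5 = 0" for n :: nat
    by presburger
  have "{k. d dvd k} = {k. k mod (5*d) = d} \<union> ({k. k mod (5*d) = 2*d} \<union>
    ({k. k mod (5*d) = 3*d} \<union> ({k. k mod (5*d) = 4*d} \<union> {k. 5*d dvd k})))"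
    unfolding * mult_dvd_iff[OF assms] mod_mult_eq_iff[OF assms] using cases by auto
  thus ?thesis
    by (simp only:) (unfold * mult_dvd_iff[OF assms] mod_mult_eq_iff[OF assms], (subst eprod_Un, force)+, rule refl)
qed

lemma eprod_odd_multiples_5:
  "eprod s {k. k mod 2 = 1} = eprod s {k. k mod 10 = 1} * (eprod s {k. k mod 10 = 3} *
    (eprod s {k. k mod 10 = 7} * (eprod s {k. k mod 10 = 9} * eprod s {k. k mod 10 = 5})))"
proof -
  have "n mod 2 = 1 \<longleftrightarrow> n mod 10 = 1 \<or> n mod 10 = 3 \<or> n mod 10 = 7 \<or> n mod 10 = 9 \<or> n mod 10 = 5" for n :: nat
  proof -
    have "m mod 2 = 1 \<longleftrightarrow> m = 1 \<or> m = 3 \<or> m = 7 \<or> m = 9 \<or> m = 5" if "m < 10" for m :: nat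
    proof -
      have "m = 0 \<or> m = 1 \<or> m = 2 \<or> m = 3 \<or> m = 4 \<or> m = 5 \<or> m = 6 \<or> m = 7 \<or> m = 8 \<or> m = 9"
        using that by (auto simp: numeral_eq_Suc less_Suc_eq)
      thus ?thesis
        by (elim disjE) simp_all
    qed
    from this[of "n mod 10"] show ?thesis
      by (simp add: mod_mod_cancel)
  qed
  hence "{k :: nat. k mod 2 = 1} = {k. k mod 10 = 1} \<union> ({k. k mod 10 = 3} \<union>
    ({k. k mod 10 = 7} \<union> ({k. k mod 10 = 9} \<union> {k. k mod 10 = 5})))"
    by auto
  thus ?thesis
    by (simp only:) ((subst eprod_Un, force)+, rule refl)
qed

lemma euler_f_nonzero: "m > 0 \<Longrightarrow> euler_f m \<noteq> 0"
  by (simp add: euler_f_eq_eprod eprod_nonzero)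

lemma eprod_pos_multiples:
  assumes "d > 0"
  shows "eprod 1 {k. d dvd k} * euler_f d = euler_f (2*d)"
proof -
  have "(\<lambda>k. 2 * k) ` {k. d dvd k} = {k. 2*d dvd k}"
    by (auto simp: dvd_def)
  thus ?thesis
    using assms by (simp add: euler_f_eq_eprod eprod_pos_neg)
qed

text \<open>The product over all multiples of \<open>d\<close>, divided by that over the even ones;
  each is evaluated by \<open>eprod_pos_multiples\<close>.\<close>

lemma eprod_pos_odd_multiples:
  assumes "d > 0"
  shows "eprod 1 {k. k mod (2*d) = d} * (euler_f d * euler_f (4*d)) = (euler_f (2*d))\<^sup>2"
proof -
  have 4: "euler_f (4*d) = eprod 1 {k. 2*d dvd k} * euler_f (2*d)"
    using eprod_pos_multiples[of "2*d"] assms by simp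
  have "eprod 1 {k. k mod (2*d) = d} * (euler_f d * euler_f (4*d)) =
      (eprod 1 {k. d dvd k} * euler_f d) * euler_f (2*d)"
    unfolding 4 eprod_multiples_2[OF assms, of 1] by (simp only: mult_ac)
  thus ?thesis
    by (simp only: eprod_pos_multiples[OF assms] power2_eq_square)
qed

section \<open>Theta series as quotients of Euler products\<close>

lemma theta_diag_pos_product:
  assumes "d > 0"
  shows "theta d d 1 * (euler_f d * euler_f (4*d))\<^sup>2 = euler_f (2*d) ^ 5"
proof -
  have "theta d d 1 = (eprod 1 {k. k mod (2*d) = d})\<^sup>2 * euler_f (2*d)"
    using jacobi_triple_product[OF assms assms, of 1] by (simp add: power2_eq_square flip: mult_2)
  thus ?thesis
    using eprod_pos_odd_multiples[OF assms] by algebra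
qed

lemma theta_diag_neg_product:
  assumes "d > 0"
  shows "theta d d (-1) * euler_f (2*d) = (euler_f d)\<^sup>2"
proof -
  have "theta d d (-1) = (eprod (-1) {k. k mod (2*d) = d})\<^sup>2 * euler_f (2*d)"
    using jacobi_triple_product[OF assms assms, of "-1"] by (simp add: power2_eq_square flip: mult_2)
  moreover have "euler_f d = eprod (-1) {k. k mod (2*d) = d} * euler_f (2*d)"
    using eprod_multiples_2[OF assms, of "-1"] assms by (simp add: euler_f_eq_eprod)
  ultimately show ?thesis
    by algebra
qed

lemma theta_triangular_product:
  assumes "d > 0"
  shows "theta d (3*d) 1 * euler_f d = (euler_f (2*d))\<^sup>2"
proof -
  have "d + 3 * d = 4 * d" by simp
  hence "theta d (3*d) 1 = eprod 1 {k. k mod (2*d) = d} * euler_f (4*d)"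
    using jacobi_triple_product[of d "3*d" 1] assms by (simp only: eprod_odd_multiples_4) simp
  thus ?thesis
    using eprod_pos_odd_multiples[OF assms] by algebra
qed

text \<open>Euler's pentagonal number theorem: the classes \<open>d\<close>, \<open>2 * d\<close>
  and 0 modulo \<open>3 * d\<close> exhaust the multiples of \<open>d\<close>.\<close>

lemma theta_pentagonal:
  assumes "d > 0"
  shows "theta d (2*d) (-1) = euler_f d"
proof -
  have "d + 2 * d = 3 * d" by simp
  thus ?thesis
    using jacobi_triple_product[of d "2*d" "-1"] eprod_multiples_3[OF assms, of "-1"] assms
    by (simp only: euler_f_eq_eprod) (simp add: euler_f_eq_eprod mult.assoc)
qed

text \<open>The two triple products supply the four nonzero classes modulo \<open>5 * d\<close>; the
  remaining class is accounted for by \<open>euler_f (10*d)\<close> and one factor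
  \<open>euler_f (5*d)\<close>.\<close>

lemma theta_quintic_product_pos:
  assumes "d > 0"
  shows "theta d (4*d) 1 * theta (2*d) (3*d) 1 * (euler_f d * euler_f (10*d)) = euler_f (2*d) * euler_f (5*d) ^ 3"
proof -
  have "d + 4 * d = 5 * d" "2 * d + 3 * d = 5 * d" by simp_all
  hence 1: "theta d (4*d) 1 = eprod 1 {k. k mod (5*d) = d} * eprod 1 {k. k mod (5*d) = 4*d} * euler_f (5*d)"
    "theta (2*d) (3*d) 1 = eprod 1 {k. k mod (5*d) = 2*d} * eprod 1 {k. k mod (5*d) = 3*d} * euler_f (5*d)"
    using jacobi_triple_product[of d "4*d" 1] jacobi_triple_product[of "2*d" "3*d" 1] assms by simp_all
  have 2: "eprod 1 {k. 5*d dvd k} * euler_f (5*d) = euler_f (10*d)"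
    using eprod_pos_multiples[of "5*d"] assms by simp
  have "theta d (4*d) 1 * theta (2*d) (3*d) 1 * (euler_f d * euler_f (10*d)) =
      (eprod 1 {k. d dvd k} * euler_f d) * euler_f (5*d) ^ 3"
    unfolding 1 2[symmetric] eprod_multiples_5[OF assms] by (simp add: power3_eq_cube mult_ac)
  thus ?thesis
    by (simp only: eprod_pos_multiples[OF assms])
qed

lemma theta_quintic_product_neg:
  "theta 1 4 (-1) * theta 2 3 (-1) = euler_f 1 * euler_f 5"
proof -
  have "theta 1 4 (-1) = eprod (-1) {k. k mod 5 = 1} * eprod (-1) {k. k mod 5 = 4} * euler_f 5"
    "theta 2 3 (-1) = eprod (-1) {k. k mod 5 = 2} * eprod (-1) {k. k mod 5 = 3} * euler_f 5"
    using jacobi_triple_product[of 1 4 "-1"] jacobi_triple_product[of 2 3 "-1"] by simp_all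
  moreover have "euler_f 1 = eprod (-1) {k. k mod 5 = 1} * (eprod (-1) {k. k mod 5 = 2} *
    (eprod (-1) {k. k mod 5 = 3} * (eprod (-1) {k. k mod 5 = 4} * euler_f 5)))"
    using eprod_multiples_5[of 1 "-1"] by (simp add: euler_f_eq_eprod)
  ultimately show ?thesis
    by (simp only: mult_ac)
qed

lemma theta_decic_product:
  "theta 3 7 1 * theta 9 1 1 * (euler_f 1 * euler_f 4) = (euler_f 2)\<^sup>2 * euler_f 5 * euler_f 20"
proof -
  have 1: "theta 3 7 1 = eprod 1 {k. k mod 10 = 3} * eprod 1 {k. k mod 10 = 7} * euler_f 10"
    "theta 9 1 1 = eprod 1 {k. k mod 10 = 9} * eprod 1 {k. k mod 10 = 1} * euler_f 10"
    using jacobi_triple_product[of 3 7 1] jacobi_triple_product[of 9 1 1] by simp_all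
  have 2: "eprod 1 {k. k mod 2 = 1} * (euler_f 1 * euler_f 4) = (euler_f 2)\<^sup>2"
    "eprod 1 {k. k mod 10 = 5} * (euler_f 5 * euler_f 20) = (euler_f 10)\<^sup>2"
    using eprod_pos_odd_multiples[of 1] eprod_pos_odd_multiples[of 5] by simp_all
  \<comment> \<open>The classes 1, 3, 7, 9 modulo 10 lack only class 5 to make up the odd numbers;
    it is inserted through its evaluation, and the square of \<open>euler_f 10\<close> is cancelled
    at the end.\<close>
  have "(theta 3 7 1 * theta 9 1 1 * (euler_f 1 * euler_f 4)) * (euler_f 10)\<^sup>2 =
      (theta 3 7 1 * theta 9 1 1 * (euler_f 1 * euler_f 4)) * (eprod 1 {k. k mod 10 = 5} * (euler_f 5 * euler_f 20))"
    by (simp only: 2(2))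
  also have "\<dots> = (eprod 1 {k. k mod 2 = 1} * (euler_f 1 * euler_f 4)) * (euler_f 5 * euler_f 20) * (euler_f 10)\<^sup>2"
    unfolding 1 eprod_odd_multiples_5 by (simp only: power2_eq_square mult_ac)
  finally show ?thesis
    unfolding 2(1) using euler_f_nonzero[of 10] by (simp add: mult.assoc)
qed

section \<open>Bisection\<close>

lemma theta_diag_mult_triangular:
  assumes "d > 0"
  shows "theta d d 1 * theta (2*d) (6*d) 1 = (theta d (3*d) 1)\<^sup>2"
proof -
  \<comment> \<open>Collects the denominators of the three product formulas, which then reduce the
    claim to algebra.\<close>
  let ?c = "(euler_f (4*d))\<^sup>2 * (euler_f d)\<^sup>2 * euler_f (2*d)"
  have 1: "theta d d 1 * (euler_f d * euler_f (4*d))\<^sup>2 = euler_f (2*d) ^ 5"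
    and 2: "theta (2*d) (6*d) 1 * euler_f (2*d) = (euler_f (4*d))\<^sup>2"
    and 3: "theta d (3*d) 1 * euler_f d = (euler_f (2*d))\<^sup>2"
    using theta_diag_pos_product[OF assms] theta_triangular_product[of "2*d"] theta_triangular_product[of d] assms by simp_all
  have "theta d d 1 * theta (2*d) (6*d) 1 * ?c = (theta d (3*d) 1)\<^sup>2 * ?c"
    using 1 2 3 by algebra
  moreover have "?c \<noteq> 0"
    using assms by (simp add: euler_f_nonzero)
  ultimately show ?thesis
    by (rule mult_right_cancel[THEN iffD1, rotated])
qed

lemma theta_diag_neg_mult_pos:
  assumes "d > 0"
  shows "theta d d (-1) * theta d d 1 = (theta (2*d) (2*d) (-1))\<^sup>2"
proof -
  let ?c = "(euler_f (4*d))\<^sup>2 * (euler_f d)\<^sup>2 * euler_f (2*d)"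
  have 1: "theta d d 1 * (euler_f d * euler_f (4*d))\<^sup>2 = euler_f (2*d) ^ 5"
    and 2: "theta d d (-1) * euler_f (2*d) = (euler_f d)\<^sup>2"
    and 3: "theta (2*d) (2*d) (-1) * euler_f (4*d) = (euler_f (2*d))\<^sup>2"
    using theta_diag_pos_product[OF assms] theta_diag_neg_product[of "2*d"] theta_diag_neg_product[of d] assms by simp_all
  have "theta d d (-1) * theta d d 1 * ?c = (theta (2*d) (2*d) (-1))\<^sup>2 * ?c"
    using 1 2 3 by algebra
  moreover have "?c \<noteq> 0"
    using assms by (simp add: euler_f_nonzero)
  ultimately show ?thesis
    by (rule mult_right_cancel[THEN iffD1, rotated])
qed

lemma theta_diag_neg_mult_triangular:
  assumes "d > 0"
  shows "theta d d (-1) * theta d (3*d) 1 = euler_f d * euler_f (2*d)"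
proof -
  let ?c = "euler_f d * euler_f (2*d)"
  have 1: "theta d d (-1) * euler_f (2*d) = (euler_f d)\<^sup>2"
    and 2: "theta d (3*d) 1 * euler_f d = (euler_f (2*d))\<^sup>2"
    using theta_diag_neg_product[OF assms] theta_triangular_product[OF assms] by simp_all
  have "theta d d (-1) * theta d (3*d) 1 * ?c = ?c * ?c"
    using 1 2 by algebra
  moreover have "?c \<noteq> 0"
    using assms by (simp add: euler_f_nonzero)
  ultimately show ?thesis
    by (rule mult_right_cancel[THEN iffD1, rotated])
qed

text \<open>Half of \<open>theta_pentagonal_product\<close>, with both factors on its left evaluated
  by the pentagonal number theorem.\<close>

lemma euler_f_mult_5:
  assumes "d > 0"
  shows "euler_f d * euler_f (5*d) =
    theta (2*d) (6*d) 1 * theta (5*d) (5*d) 1 - fps_X ^ d * (theta d d 1 * theta (10*d) (30*d) 1)"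
proof -
  have "2 * (euler_f d * euler_f (5*d)) = 2 * (theta (2*d) (6*d) 1 * theta (5*d) (5*d) 1 -
      fps_X ^ d * (theta d d 1 * theta (10*d) (30*d) 1))"
    using theta_pentagonal_product[OF assms] theta_pentagonal[of d] theta_pentagonal[of "5*d"]
      theta_triangular[of "2*d"] theta_triangular[of "10*d"] assms
    by (simp add: algebra_simps)
  thus ?thesis
    by (rule mult_left_cancel[THEN iffD1, rotated]) simp
qed

section \<open>The series \<open>P\<close>, \<open>Q\<close>, \<open>z\<close>
  (\<open>psi1_sq\<close>, \<open>psi5_sq\<close>, \<open>euler_f_1_5\<close>) and their
  relations\<close>

definition psi1_sq where "psi1_sq = (theta 1 3 1)\<^sup>2"
definition psi5_sq where "psi5_sq = fps_X * (theta 5 15 1)\<^sup>2"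
definition euler_f_1_5 where "euler_f_1_5 = euler_f 1 * euler_f 5"

lemma psi1_sq_euler_f: "psi1_sq * (euler_f 1)\<^sup>2 = euler_f 2 ^ 4"
  unfolding psi1_sq_def using theta_triangular_product[of 1] by (simp, algebra)

lemma psi5_sq_euler_f: "psi5_sq * (euler_f 5)\<^sup>2 = fps_X * euler_f 10 ^ 4"
  unfolding psi5_sq_def using theta_triangular_product[of 5] by (simp, algebra)

lemma psi_sq_diff: "psi1_sq - psi5_sq = theta 1 4 1 * theta 2 3 1"
proof -
  have "4 * (psi1_sq - psi5_sq) = 4 * (theta 1 4 1 * theta 2 3 1)"
    using theta_1_0_square theta_triangular[of 1] theta_triangular[of 5]
    by (simp add: psi1_sq_def psi5_sq_def power_mult_distrib algebra_simps)
  thus ?thesis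
    by (rule mult_left_cancel[THEN iffD1, rotated]) simp
qed

lemma psi_sq_diff_euler_f: "(psi1_sq - psi5_sq) * (euler_f 1 * euler_f 10) = euler_f 2 * euler_f 5 ^ 3"
  using theta_quintic_product_pos[of 1] by (simp add: psi_sq_diff)

text \<open>By \<open>theta_14_23\<close>, \<open>P - Q = A + B\<close> and
  \<open>z = A - B\<close>, so \<open>(P - Q)^2 - z^2 = 4 A B\<close>; comparing products shows
  \<open>A B = Q (P - Q)\<close>.\<close>

lemma euler_f_1_5_square: "euler_f_1_5\<^sup>2 = (psi1_sq - psi5_sq) * (psi1_sq - 5 * psi5_sq)"
proof -
  \<comment> \<open>The four theta factors of \<open>A B\<close> are regrouped into
    \<open>\<kappa>\<close> and \<open>\<mu>\<close>, which both have product evaluations.\<close>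
  define \<kappa> where "\<kappa> = theta 8 2 1 * theta 4 6 1"
  define \<mu> where "\<mu> = theta 3 7 1 * theta 9 1 1"
  have "\<kappa> * (euler_f 2 * euler_f 20) = euler_f 4 * euler_f 10 ^ 3"
  proof -
    have "theta 8 2 1 = theta 2 8 1"
      using jacobi_triple_product[of 8 2 1] jacobi_triple_product[of 2 8 1] by simp
    thus ?thesis
      using theta_quintic_product_pos[of 2] by (simp add: \<kappa>_def)
  qed
  moreover have "\<mu> * (euler_f 1 * euler_f 4) = (euler_f 2)\<^sup>2 * euler_f 5 * euler_f 20"
    unfolding \<mu>_def by (rule theta_decic_product)
  ultimately have "(fps_X * \<kappa> * \<mu>) * (euler_f 1 * (euler_f 2 * euler_f 4 * euler_f 20 * euler_f 5 ^ 2 * euler_f 10)) =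
      (psi5_sq * (psi1_sq - psi5_sq)) * (euler_f 1 * (euler_f 2 * euler_f 4 * euler_f 20 * euler_f 5 ^ 2 * euler_f 10))"
    using psi_sq_diff_euler_f psi5_sq_euler_f by algebra
  hence QPQ: "fps_X * \<kappa> * \<mu> = psi5_sq * (psi1_sq - psi5_sq)"
    by (simp only: mult_right_cancel euler_f_nonzero mult_eq_0_iff power_eq_0_iff zero_less_numeral zero_less_one simp_thms)
  have 1: "psi1_sq - psi5_sq = theta 3 7 1 * theta 4 6 1 + fps_X * (theta 8 2 1 * theta 9 1 1)"
    using theta_14_23[of 1] by (simp add: psi_sq_diff)
  have "euler_f_1_5 = theta 3 7 1 * theta 4 6 1 + fps_const (-1) * (fps_X * (theta 8 2 1 * theta 9 1 1))"
    unfolding euler_f_1_5_def theta_quintic_product_neg[symmetric] by (rule theta_14_23) simp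
  hence 2: "euler_f_1_5 = theta 3 7 1 * theta 4 6 1 - fps_X * (theta 8 2 1 * theta 9 1 1)"
    by (simp flip: fps_const_neg)
  have "(psi1_sq - psi5_sq)\<^sup>2 - euler_f_1_5\<^sup>2 = 4 * (fps_X * \<kappa> * \<mu>)"
    unfolding 1 2 \<kappa>_def \<mu>_def by algebra
  thus ?thesis
    unfolding QPQ by algebra
qed

text \<open>Obtained by dividing \<open>z^2 = (P - Q) (P - 5 Q)\<close> by the known product for
  \<open>P - Q\<close>.\<close>

lemma psi_sq_diff_5_euler_f: "(psi1_sq - 5 * psi5_sq) * (euler_f 2 * euler_f 5) = euler_f 1 ^ 3 * euler_f 10"
proof -
  have "(psi1_sq - 5 * psi5_sq) * (euler_f 2 * euler_f 5) * (euler_f 5)\<^sup>2 = euler_f 1 ^ 3 * euler_f 10 * (euler_f 5)\<^sup>2"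
    using euler_f_1_5_square psi_sq_diff_euler_f unfolding euler_f_1_5_def by algebra
  thus ?thesis
    using euler_f_nonzero[of 5] by simp
qed

text \<open>\<open>F\<close> and \<open>G\<close> of the overview: the shifts by 1 and 2 move both
  progressions of the claim to the multiples of \<open>2^k\<close>.\<close>

definition M_series where "M_series = fps_X * Abs_fps M"
definition Tstar_series where "Tstar_series = fps_X ^ 2 * Abs_fps Tstar"

lemma M_series_eq: "M_series = fps_X * psi1_sq * (psi1_sq - psi5_sq) * euler_f_1_5\<^sup>2"
proof -
  have "M_series * (euler_f 1 * euler_f 10) = fps_X * psi1_sq * (psi1_sq - psi5_sq) * euler_f_1_5\<^sup>2 * (euler_f 1 * euler_f 10)"
    using M_generating_function psi_sq_diff_euler_f psi1_sq_euler_f unfolding M_series_def euler_f_1_5_def by algebra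
  thus ?thesis
    using euler_f_nonzero by simp
qed

lemma Tstar_series_eq: "Tstar_series = fps_X * psi5_sq * (psi1_sq - 5 * psi5_sq) * euler_f_1_5\<^sup>2"
proof -
  have "Tstar_series * (euler_f 2 * euler_f 5) = fps_X * psi5_sq * (psi1_sq - 5 * psi5_sq) * euler_f_1_5\<^sup>2 * (euler_f 2 * euler_f 5)"
    using Tstar_generating_function psi_sq_diff_5_euler_f psi5_sq_euler_f unfolding Tstar_series_def euler_f_1_5_def by algebra
  thus ?thesis
    using euler_f_nonzero by simp
qed

section \<open>The operator \<open>U\<close> (\<open>bisect\<close>) and the substitution of
  \<open>q^2\<close> for \<open>q\<close> (\<open>dilate\<close>)\<close>

definition bisect where "bisect A = Abs_fps (\<lambda>n. fps_nth A (2 * n))" for A :: "int fps"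
definition dilate where "dilate A = A oo (fps_X ^ 2)" for A :: "int fps"

lemma dilate_simps:
  "dilate (A + B) = dilate A + dilate B" "dilate (A - B) = dilate A - dilate B"
  "dilate (A * B) = dilate A * dilate B" "dilate (A ^ n) = dilate A ^ n"
  "dilate fps_X = fps_X ^ 2" "dilate (- A) = - dilate A" "dilate (numeral k) = numeral k" "dilate (- numeral k) = - numeral k"
  by (simp_all add: dilate_def fps_compose_add_distrib fps_compose_sub_distrib fps_compose_uminus fps_compose_mult_distrib
    fps_compose_power flip: fps_compose_power)

lemma dilate_nth: "fps_nth (dilate A) n = (if even n then fps_nth A (n div 2) else 0)"
  by (simp add: dilate_def fps_nth_compose_X_power)

lemma dilate_theta: "dilate (theta i j s) = theta (2*i) (2*j) s"
proof (rule fps_ext)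
  fix n
  have "theta_exp (2*i) (2*j) m = 2 * theta_exp i j m" for m
    by (simp add: theta_exp_def)
  hence "theta_exp (2*i) (2*j) m = int n \<longleftrightarrow> even n \<and> theta_exp i j m = int (n div 2)" for m
    by presburger
  thus "fps_nth (dilate (theta i j s)) n = fps_nth (theta (2*i) (2*j) s) n"
    by (simp add: dilate_nth theta_def lattice_series_def)
qed

text \<open>Read off from the pentagonal series, which avoids substituting into an infinite
  product.\<close>

lemma dilate_euler_f: "d > 0 \<Longrightarrow> dilate (euler_f d) = euler_f (2*d)"
  using dilate_theta[of d "2*d" "-1"] theta_pentagonal[of d] theta_pentagonal[of "2*d"] by simp

text \<open>The means of computing \<open>U\<close>: split a series into odd and even part and keep
  the latter.\<close>

lemma bisect_dilate: "bisect (fps_X * dilate A + dilate B) = B"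
  by (rule fps_ext) (simp add: bisect_def dilate_nth)

definition newform where "newform = fps_X * euler_f 1 ^ 4 * euler_f 5 ^ 4"
definition newform_dilated where "newform_dilated = fps_X ^ 2 * euler_f 2 ^ 4 * euler_f 10 ^ 4"

lemma bisect_newform_dilated: "bisect newform_dilated = newform"
proof -
  have "newform_dilated = fps_X * dilate 0 + dilate newform"
    by (simp add: newform_def newform_dilated_def dilate_simps dilate_euler_f) (simp add: dilate_def)
  hence "bisect newform_dilated = bisect (fps_X * dilate 0 + dilate newform)"
    by (rule arg_cong)
  thus ?thesis
    unfolding bisect_dilate .
qed

lemma newform_dilated_eq: "newform_dilated = fps_X * psi1_sq * psi5_sq * euler_f_1_5\<^sup>2"
  using psi1_sq_euler_f psi5_sq_euler_f unfolding newform_dilated_def euler_f_1_5_def by algebra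

text \<open>By the product for \<phi>(-q), \<open>h\<close> is \<open>q\<close> times the squares of
  \<phi>(-q), \<phi>(-q^5), \<open>f_2\<close> and \<open>f_10\<close>. The last two are series in
  \<open>q^2\<close>, and \<open>theta_diag_square\<close> splits the first two by parity.\<close>

lemma bisect_newform: "bisect newform = - 4 * newform - 8 * newform_dilated"
proof -
  define a where "a = theta 1 1 1"
  define b where "b = theta 2 6 1"
  define c where "c = theta 5 5 1"
  define d where "d = theta 10 30 1"
  have 1: "(theta 1 1 (-1))\<^sup>2 = dilate a ^ 2 - 4 * fps_X * dilate b ^ 2"
    using theta_diag_square[of 1 "-1"] theta_triangular[of 4]
    by (simp add: a_def b_def dilate_theta power_mult_distrib flip: fps_const_neg)
  have 2: "(theta 5 5 (-1))\<^sup>2 = dilate c ^ 2 - 4 * fps_X ^ 5 * dilate d ^ 2"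
    using theta_diag_square[of 5 "-1"] theta_triangular[of 20]
    by (simp add: c_def d_def dilate_theta power_mult_distrib flip: fps_const_neg)
  have "theta 1 1 (-1) * euler_f 2 = (euler_f 1)\<^sup>2" "theta 5 5 (-1) * euler_f 10 = (euler_f 5)\<^sup>2"
    using theta_diag_neg_product[of 1] theta_diag_neg_product[of 5] by simp_all
  hence "newform = fps_X * ((theta 1 1 (-1))\<^sup>2 * (theta 5 5 (-1))\<^sup>2) * (euler_f 2)\<^sup>2 * (euler_f 10)\<^sup>2"
    unfolding newform_def by algebra
  also have "\<dots> = fps_X * dilate (((a * c)\<^sup>2 + 16 * fps_X ^ 3 * (b * d)\<^sup>2) * (euler_f 1)\<^sup>2 * (euler_f 5)\<^sup>2) +
      dilate (-4 * fps_X * ((b * c)\<^sup>2 + fps_X ^ 2 * (a * d)\<^sup>2) * (euler_f 1)\<^sup>2 * (euler_f 5)\<^sup>2)"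
    (is "_ = fps_X * dilate ?A + dilate ?B")
    unfolding 1 2 by (simp add: dilate_simps dilate_euler_f) algebra
  finally have "bisect newform = bisect (fps_X * dilate ?A + dilate ?B)"
    by (rule arg_cong)
  hence "bisect newform = -4 * fps_X * ((b * c)\<^sup>2 + fps_X ^ 2 * (a * d)\<^sup>2) * euler_f_1_5\<^sup>2"
    unfolding bisect_dilate by (simp only: euler_f_1_5_def power_mult_distrib mult_ac)
  \<comment> \<open>With \<open>a b = P\<close> and \<open>q c d = Q\<close>, squaring this gives
    \<open>(b c)^2 + q^2 (a d)^2 = z^2 + 2 P Q\<close>.\<close>
  moreover have "euler_f_1_5 = b * c - fps_X * (a * d)"
    using euler_f_mult_5[of 1] by (simp add: euler_f_1_5_def a_def b_def c_def d_def)
  moreover have "a * b = psi1_sq" "fps_X * (c * d) = psi5_sq"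
    using theta_diag_mult_triangular[of 1] theta_diag_mult_triangular[of 5]
    by (simp_all add: a_def b_def c_def d_def psi1_sq_def psi5_sq_def)
  moreover have "newform = fps_X * euler_f_1_5 ^ 4"
    by (simp add: newform_def euler_f_1_5_def power_mult_distrib mult.assoc)
  ultimately show ?thesis
    unfolding newform_dilated_eq by algebra
qed

text \<open>Here \<open>F + G = q z^2 (P^2 - 5 Q^2)\<close>. It is rewritten so that, besides
  \<open>q\<close> and series in \<open>q^2\<close>, only \<phi>(q), \<phi>(-q), \<phi>(q^5) and
  \<phi>(-q^5) occur; these are split by \<open>theta_diag_even_odd\<close>.\<close>

lemma bisect_sum: "bisect (M_series + Tstar_series) = 2 * (M_series + Tstar_series)"
proof -
  define a where "a = theta 2 2 1"
  define b where "b = theta 4 12 1"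
  define c where "c = theta 10 10 1"
  define d where "d = theta 20 60 1"
  have 1: "theta 1 1 1 = dilate a + 2 * fps_X * dilate b" "theta 1 1 (-1) = dilate a - 2 * fps_X * dilate b"
    using theta_diag_even_odd[of 1 1] theta_diag_even_odd[of 1 "-1"] theta_triangular[of 8]
    by (simp_all add: a_def b_def dilate_theta flip: fps_const_neg)
  have 2: "theta 5 5 1 = dilate c + 2 * fps_X ^ 5 * dilate d" "theta 5 5 (-1) = dilate c - 2 * fps_X ^ 5 * dilate d"
    using theta_diag_even_odd[of 5 1] theta_diag_even_odd[of 5 "-1"] theta_triangular[of 40]
    by (simp_all add: c_def d_def dilate_theta flip: fps_const_neg)
  have e1: "theta 1 1 (-1) * euler_f 2 = (euler_f 1)\<^sup>2" "theta 5 5 (-1) * euler_f 10 = (euler_f 5)\<^sup>2"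
    using theta_diag_neg_product[of 1] theta_diag_neg_product[of 5] by simp_all
  have PQ: "theta 1 1 1 * theta 2 6 1 = psi1_sq" "fps_X * (theta 5 5 1 * theta 10 30 1) = psi5_sq"
    using theta_diag_mult_triangular[of 1] theta_diag_mult_triangular[of 5] by (simp_all add: psi1_sq_def psi5_sq_def)
  have neg_pos: "theta 1 1 (-1) * theta 1 1 1 = (theta 2 2 (-1))\<^sup>2" "theta 5 5 (-1) * theta 5 5 1 = (theta 10 10 (-1))\<^sup>2"
    using theta_diag_neg_mult_pos[of 1] theta_diag_neg_mult_pos[of 5] by simp_all
  have neg_tri: "theta 2 2 (-1) * theta 2 6 1 = euler_f 2 * euler_f 4" "theta 10 10 (-1) * theta 10 30 1 = euler_f 10 * euler_f 20"
    using theta_diag_neg_mult_triangular[of 2] theta_diag_neg_mult_triangular[of 10] by simp_all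
  have "theta 1 1 (-1) * psi1_sq\<^sup>2 = theta 1 1 1 * (euler_f 2 * euler_f 4)\<^sup>2"
  proof -
    have "theta 1 1 (-1) * psi1_sq\<^sup>2 = (theta 1 1 (-1) * theta 1 1 1) * theta 1 1 1 * (theta 2 6 1)\<^sup>2"
      by (simp only: PQ(1)[symmetric] power2_eq_square mult_ac)
    also have "\<dots> = theta 1 1 1 * (euler_f 2 * euler_f 4)\<^sup>2"
      unfolding neg_pos by (simp only: neg_tri[symmetric] power2_eq_square mult_ac)
    finally show ?thesis .
  qed
  moreover have "theta 5 5 (-1) * psi5_sq\<^sup>2 = fps_X ^ 2 * theta 5 5 1 * (euler_f 10 * euler_f 20)\<^sup>2"
  proof -
    have "theta 5 5 (-1) * psi5_sq\<^sup>2 = fps_X ^ 2 * (theta 5 5 (-1) * theta 5 5 1) * theta 5 5 1 * (theta 10 30 1)\<^sup>2"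
      by (simp only: PQ(2)[symmetric] power2_eq_square mult_ac)
    also have "\<dots> = fps_X ^ 2 * theta 5 5 1 * (euler_f 10 * euler_f 20)\<^sup>2"
      unfolding neg_pos by (simp only: neg_tri[symmetric] power2_eq_square mult_ac)
    finally show ?thesis .
  qed
  moreover have "M_series + Tstar_series = fps_X * euler_f_1_5\<^sup>2 * (psi1_sq\<^sup>2 - 5 * psi5_sq\<^sup>2)"
    unfolding M_series_eq Tstar_series_eq by algebra
  ultimately have "M_series + Tstar_series = fps_X * euler_f 2 * euler_f 10 * (theta 1 1 1 * theta 5 5 (-1) * (euler_f 2 * euler_f 4)\<^sup>2
      - 5 * fps_X ^ 2 * theta 1 1 (-1) * theta 5 5 1 * (euler_f 10 * euler_f 20)\<^sup>2)"
    using e1 unfolding euler_f_1_5_def by algebra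
  also have "\<dots> = fps_X * dilate (euler_f 1 * euler_f 5 * (a * c - 4 * fps_X ^ 3 * (b * d)) *
        ((euler_f 1 * euler_f 2)\<^sup>2 - 5 * fps_X * (euler_f 5 * euler_f 10)\<^sup>2)) +
      dilate (2 * fps_X * (euler_f 1 * euler_f 5) * (b * c - fps_X ^ 2 * (a * d)) *
        ((euler_f 1 * euler_f 2)\<^sup>2 + 5 * fps_X * (euler_f 5 * euler_f 10)\<^sup>2))"
    unfolding 1 2 by (simp add: dilate_simps dilate_euler_f) algebra
  also have "b * c - fps_X ^ 2 * (a * d) = euler_f 2 * euler_f 10"
    using euler_f_mult_5[of 2] by (simp add: a_def b_def c_def d_def)
  finally have "bisect (M_series + Tstar_series) = 2 * fps_X * (euler_f 1 * euler_f 5) * (euler_f 2 * euler_f 10) *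
      ((euler_f 1 * euler_f 2)\<^sup>2 + 5 * fps_X * (euler_f 5 * euler_f 10)\<^sup>2)"
    by (simp only: bisect_dilate)
  \<comment> \<open>Returns to \<open>P\<close>, \<open>Q\<close>, \<open>z\<close> through the
    products for \<open>P (P - 5 Q) z\<close> and \<open>Q (P - Q) z\<close>. The last factor is
    \<open>P^2 - 5 Q^2\<close> again.\<close>
  also have "\<dots> = 2 * fps_X * euler_f_1_5\<^sup>2 * (psi1_sq * (psi1_sq - 5 * psi5_sq) + 5 * (psi5_sq * (psi1_sq - psi5_sq)))"
  proof -
    have "psi1_sq * (psi1_sq - 5 * psi5_sq) * euler_f_1_5 * ((euler_f 1)\<^sup>2 * euler_f 2) =
        (euler_f 1)\<^sup>2 * euler_f 2 ^ 3 * euler_f 10 * ((euler_f 1)\<^sup>2 * euler_f 2)"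
      using psi1_sq_euler_f psi_sq_diff_5_euler_f unfolding euler_f_1_5_def by algebra
    hence "psi1_sq * (psi1_sq - 5 * psi5_sq) * euler_f_1_5 = (euler_f 1)\<^sup>2 * euler_f 2 ^ 3 * euler_f 10"
      using euler_f_nonzero by simp
    moreover have "psi5_sq * (psi1_sq - psi5_sq) * euler_f_1_5 * ((euler_f 5)\<^sup>2 * euler_f 10) =
        fps_X * euler_f 2 * (euler_f 5)\<^sup>2 * euler_f 10 ^ 3 * ((euler_f 5)\<^sup>2 * euler_f 10)"
      using psi5_sq_euler_f psi_sq_diff_euler_f unfolding euler_f_1_5_def by algebra
    hence "psi5_sq * (psi1_sq - psi5_sq) * euler_f_1_5 = fps_X * euler_f 2 * (euler_f 5)\<^sup>2 * euler_f 10 ^ 3"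
      using euler_f_nonzero by simp
    ultimately show ?thesis
      unfolding euler_f_1_5_def by algebra
  qed
  also have "\<dots> = 2 * (M_series + Tstar_series)"
    unfolding M_series_eq Tstar_series_eq by algebra
  finally show ?thesis .
qed

text \<open>Amounts to \<open>P (P - Q) - Q (P - 5 Q) = z^2 + 4 P Q\<close>, multiplied by
  \<open>q z^2\<close>.\<close>

lemma series_diff: "M_series - Tstar_series = newform + 4 * newform_dilated"
proof -
  have "newform = fps_X * (euler_f_1_5\<^sup>2)\<^sup>2"
    by (simp add: newform_def euler_f_1_5_def power_mult_distrib mult.assoc)
  thus ?thesis
    unfolding M_series_eq Tstar_series_eq newform_dilated_eq euler_f_1_5_square by algebra
qed

section \<open>Iterating \<open>U\<close> and 2-divisibility\<close>

lemma bisect_linear: "bisect (A + B) = bisect A + bisect B" "bisect (fps_const c * A) = fps_const c * bisect A"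
  by (rule fps_ext, simp add: bisect_def)+

lemma bisect_funpow_nth: "fps_nth ((bisect ^^ k) A) n = fps_nth A (2 ^ k * n)"
  by (induction k arbitrary: n) (simp_all add: bisect_def mult_ac)

lemma bisect_funpow_sum: "(bisect ^^ k) (M_series + Tstar_series) = fps_const (2 ^ k) * (M_series + Tstar_series)"
proof (induction k)
  case (Suc k)
  have "bisect (M_series + Tstar_series) = fps_const 2 * (M_series + Tstar_series)"
    by (simp only: bisect_sum numeral_fps_const)
  hence "(bisect ^^ Suc k) (M_series + Tstar_series) = fps_const (2 ^ k) * (fps_const 2 * (M_series + Tstar_series))"
    by (simp only: funpow.simps comp_apply Suc bisect_linear(2))
  thus ?case
    by (simp only: power_Suc fps_const_mult[symmetric] mult_ac)
qed simp

text \<open>\<open>U\<close> sends \<open>h(q^2)\<close> to \<open>h\<close> without gaining a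
  factor 2, so the invariant keeps the coefficient of \<open>h(q^2)\<close> even:
  \<open>a h + 2 b h(q^2)\<close> goes to \<open>2 ((b - 2 a) h - 4 a h(q^2))\<close>.\<close>

lemma bisect_funpow_diff: "\<exists>a b. (bisect ^^ k) (M_series - Tstar_series) = fps_const (2 ^ k) * (fps_const a * newform + fps_const (2 * b) * newform_dilated)"
proof (induction k)
  case 0
  have "(bisect ^^ 0) (M_series - Tstar_series) = fps_const (2 ^ 0) * (fps_const 1 * newform + fps_const (2 * 2) * newform_dilated)"
    by (simp add: series_diff numeral_fps_const)
  thus ?case by blast
next
  case (Suc k)
  then obtain a b where ab: "(bisect ^^ k) (M_series - Tstar_series) = fps_const (2 ^ k) * (fps_const a * newform + fps_const (2 * b) * newform_dilated)"
    by blast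
  have "bisect newform = fps_const (-4) * newform + fps_const (-8) * newform_dilated"
    by (intro fps_ext) (simp add: bisect_newform numeral_fps_const)
  hence "(bisect ^^ Suc k) (M_series - Tstar_series) = fps_const (2 ^ k) *
      (fps_const a * (fps_const (-4) * newform + fps_const (-8) * newform_dilated) + fps_const (2 * b) * newform)"
    by (simp add: ab bisect_linear bisect_newform_dilated del: fps_const_mult fps_const_neg)
  also have "\<dots> = fps_const (2 ^ Suc k) * (fps_const (b - 2 * a) * newform + fps_const (2 * (-2 * a)) * newform_dilated)"
    by (rule fps_ext) (simp only: fps_mult_left_const_nth fps_add_nth, simp add: algebra_simps)
  finally show ?case by blast
qed

text \<open>The sum and the difference of the two coefficients are divisible by \<open>2^k\<close>;
  solving for each coefficient costs one factor 2.\<close>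

lemma series_coeff_dvd:
  assumes "k \<ge> 1"
  shows "2 ^ (k - 1) dvd fps_nth M_series (2 ^ k * n)" "2 ^ (k - 1) dvd fps_nth Tstar_series (2 ^ k * n)"
proof -
  obtain a b where ab: "(bisect ^^ k) (M_series - Tstar_series) = fps_const (2 ^ k) * (fps_const a * newform + fps_const (2 * b) * newform_dilated)"
    using bisect_funpow_diff by blast
  have "fps_nth M_series (2 ^ k * n) + fps_nth Tstar_series (2 ^ k * n) = 2 ^ k * fps_nth (M_series + Tstar_series) n"
    using bisect_funpow_nth[of k "M_series + Tstar_series" n] by (simp add: bisect_funpow_sum)
  moreover have "fps_nth M_series (2 ^ k * n) - fps_nth Tstar_series (2 ^ k * n) = 2 ^ k * fps_nth (fps_const a * newform + fps_const (2 * b) * newform_dilated) n"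
    using bisect_funpow_nth[of k "M_series - Tstar_series" n] unfolding ab fps_mult_left_const_nth by simp
  moreover have "(2::int) ^ k = 2 * 2 ^ (k - 1)"
    using assms by (cases k) auto
  ultimately have
    "fps_nth M_series (2 ^ k * n) = 2 ^ (k - 1) * (fps_nth (M_series + Tstar_series) n + fps_nth (fps_const a * newform + fps_const (2 * b) * newform_dilated) n)"
    "fps_nth Tstar_series (2 ^ k * n) = 2 ^ (k - 1) * (fps_nth (M_series + Tstar_series) n - fps_nth (fps_const a * newform + fps_const (2 * b) * newform_dilated) n)"
    by (simp_all only: distrib_left right_diff_distrib)
  thus "2 ^ (k - 1) dvd fps_nth M_series (2 ^ k * n)" "2 ^ (k - 1) dvd fps_nth Tstar_series (2 ^ k * n)"
    by simp_all
qed

theorem theorem1p1: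
  fixes k :: nat and n :: int
  assumes "k \<ge> 1" and "n \<ge> -1"
  shows "[M (nat (2 ^ k * n + 2 ^ (k + 1) - 1)) = 0] (mod 2 ^ (k - 1)) \<and>
         [Tstar (nat (2 ^ k * n + 2 ^ (k + 1) - 2)) = 0] (mod 2 ^ (k - 1))"
proof -
  \<comment> \<open>\<open>2^k n + 2^(k+1) = 2^k (n + 2)\<close>, and \<open>n + 2\<close> is
    positive because \<open>n \<ge> -1\<close>.\<close>
  define m where "m = nat (n + 2)"
  have n: "n = int m - 2" and "m > 0"
    using assms(2) by (auto simp: m_def)
  \<comment> \<open>As \<open>2^k * m\<close> is at least 2, neither \<open>2^k * m - 1\<close> nor
    \<open>2^k * m - 2\<close> is truncated.\<close>
  hence "(2::nat) ^ 1 * 1 \<le> 2 ^ k * m"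
    using assms(1) by (intro mult_mono power_increasing) auto
  hence ge: "2 \<le> 2 ^ k * m"
    by simp
  have "2 ^ k * n + 2 ^ (k + 1) = int (2 ^ k * m)"
    by (simp add: n algebra_simps)
  hence "nat (2 ^ k * n + 2 ^ (k + 1) - 1) = 2 ^ k * m - 1" "nat (2 ^ k * n + 2 ^ (k + 1) - 2) = 2 ^ k * m - 2"
    by linarith+
  moreover have "fps_nth M_series (2 ^ k * m) = M (2 ^ k * m - 1)" "fps_nth Tstar_series (2 ^ k * m) = Tstar (2 ^ k * m - 2)"
    using ge by (auto simp: M_series_def Tstar_series_def fps_X_power_mult_nth)
  ultimately show ?thesis
    using series_coeff_dvd[OF assms(1), of m] by (simp add: cong_0_iff)
qed

end
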